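(* (i) Let $G$ be a finite connected graph (multiple edges allowed) in which every edge is a resistor of resistance $1$, and let $a,b$ be two distinct vertices of $G$. If the effective resistance $r(a,b)$ between $a$ and $b$ equals the rational number $q/p>1$, written in lowest terms with $p,q$ positive integers, then $G$ has at least $\max\{q/p,\ \log_2 q\}$ edges. (ii) There is a universal constant $C_1>0$ such that for every rational number $q/p>1$ in lowest terms there exists a finite connected planar graph $G$ (multiple edges allowed), with unit resistance on every edge, and two vertices $a,b$ of $G$ with $r(a,b)=q/p$, such that $G$ has at most $q/p+C_1\log_2 p$ edges.
   Context: Effective resistance: for a finite connected multigraph $G$ with unit resistances and distinct vertices $a,b$, let $\phi$ be the unique function on the vertices with $\phi(a)=1$, $\phi(b)=0$, and such that for every vertex $v\neq a,b$, $\sum_{e=\{v,w\}}(\phi(v)-\phi(w))=0$ (sum over edges at $v$, counted with multiplicity; Kirchhoff's current law with Ohm's law, the current along an edge $\{v,w\}$ from $v$ to $w$ being $\phi(v)-\phi(w)$). Let $I=\sum_{e=\{a,w\}}(\phi(a)-\phi(w))$ be the total current leaving $a$. Then $r(a,b)=1/I$ (potential difference divided by current). *)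

theory Defs
  imports "HOL-Analysis.Analysis"
begin

record ('v, 'e) multigraph =
  verts :: "'v set"
  edges :: "'e set"
  ends :: "'e \<Rightarrow> 'v set"

text \<open>Edges have identities of their own, so parallel edges are distinct elements of
  \<^const>\<open>edges\<close> with the same set of endpoints; loops are excluded.\<close>

locale finite_multigraph =
  fixes G :: "('v, 'e) multigraph"
  assumes finite_verts: "finite (verts G)"
    and finite_edges: "finite (edges G)"
    and ends_in_verts: "e \<in> edges G \<Longrightarrow> ends G e \<subseteq> verts G"
    and card_ends: "e \<in> edges G \<Longrightarrow> card (ends G e) = 2"

definition adj_rel :: "('v, 'e) multigraph \<Rightarrow> ('v \<times> 'v) set" where
  "adj_rel G = {(v, w). \<exists>e\<in>edges G. ends G e = {v, w}}"

definition connected_graph :: "('v, 'e) multigraph \<Rightarrow> bool" where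
  "connected_graph G \<longleftrightarrow>
     verts G \<noteq> {} \<and> (\<forall>v\<in>verts G. \<forall>w\<in>verts G. (v, w) \<in> (adj_rel G)\<^sup>*)"

definition plane_drawing ::
  "('v, 'e) multigraph \<Rightarrow> ('v \<Rightarrow> real \<times> real) \<Rightarrow> ('e \<Rightarrow> real \<Rightarrow> real \<times> real) \<Rightarrow> bool" where
  "plane_drawing G pos \<gamma> \<longleftrightarrow>
     inj_on pos (verts G) \<and>
     (\<forall>e\<in>edges G. arc (\<gamma> e) \<and>
        {pathstart (\<gamma> e), pathfinish (\<gamma> e)} = pos ` ends G e \<and>
        path_image (\<gamma> e) \<inter> pos ` verts G = pos ` ends G e) \<and>
     (\<forall>e\<in>edges G. \<forall>f\<in>edges G. e \<noteq> f \<longrightarrow>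
        path_image (\<gamma> e) \<inter> path_image (\<gamma> f) = pos ` (ends G e \<inter> ends G f))"

definition planar :: "('v, 'e) multigraph \<Rightarrow> bool" where
  "planar G \<longleftrightarrow> (\<exists>pos \<gamma>. plane_drawing G pos \<gamma>)"

definition opposite :: "('v, 'e) multigraph \<Rightarrow> 'e \<Rightarrow> 'v \<Rightarrow> 'v" where
  "opposite G e v = (THE w. ends G e = {v, w})"

definition outflow :: "('v, 'e) multigraph \<Rightarrow> ('v \<Rightarrow> real) \<Rightarrow> 'v \<Rightarrow> real" where
  "outflow G \<phi> v = (\<Sum>e | e \<in> edges G \<and> v \<in> ends G e. \<phi> v - \<phi> (opposite G e v))"

definition is_potential :: "('v, 'e) multigraph \<Rightarrow> 'v \<Rightarrow> 'v \<Rightarrow> ('v \<Rightarrow> real) \<Rightarrow> bool" where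
  "is_potential G a b \<phi> \<longleftrightarrow>
     \<phi> a = 1 \<and> \<phi> b = 0 \<and> (\<forall>v\<in>verts G - {a, b}. outflow G \<phi> v = 0)"

text \<open>Restricting to \<^const>\<open>extensional\<close> functions fixes the irrelevant values outside the
  vertex set, so that uniqueness of the potential as a function on the vertices is
  uniqueness as a HOL function.\<close>

definition potential :: "('v, 'e) multigraph \<Rightarrow> 'v \<Rightarrow> 'v \<Rightarrow> 'v \<Rightarrow> real" where
  "potential G a b = (THE \<phi>. \<phi> \<in> extensional (verts G) \<and> is_potential G a b \<phi>)"

definition effective_resistance :: "('v, 'e) multigraph \<Rightarrow> 'v \<Rightarrow> 'v \<Rightarrow> real" where
  "effective_resistance G a b = 1 / outflow G (potential G a b) a"

end

theory Submission
  imports Defs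
begin

text \<open>
  Lower bound. The number of separating two-component forests containing a vertex \<open>u\<close> in the component
  of \<open>a\<close> is a potential, whose current is the number of spanning trees. Hence the resistance is a
  ratio \<open>S / T\<close> of integers with \<open>S \<le> 2\<^sup>m\<close> and \<open>S \<le> m T\<close>, where \<open>m\<close> is the number of edges.

  Upper bound. A potential may be built from the outside in, keeping only the demanded voltage and
  current \<open>(h, r)\<close> of missing parts: a unit edge in series or in parallel performs one subtraction of the
  Euclidean algorithm, which is cheap unless \<open>h / r\<close> has large partial quotients. Splitting a part, or
  rearranging two adjacent parts into three, introduces a free integer \<open>s\<close> on which all the
  quotients depend. A nested interval argument chooses \<open>s\<close> so that all of them are badly approximable
  down to the scale \<open>\<surd>L\<close>, where \<open>L\<close> is the size of the demands. So a logarithmic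
  number of edges reduces one part to two, or two parts to three, of size about \<open>\<surd>L\<close>. Since the number of
  parts grows by less than the factor 2 by which the logarithm of their size shrinks, the total remains
  logarithmic.
\<close>

section \<open>Spanning forests and the effective resistance\<close>

text \<open>Splitting alone is not enough. If every part became two of half the logarithmic size,
  each level would again cost a multiple of log L, and about log log L levels would lose that
  factor. Rearranging two neighbouring parts into three is not a series-parallel operation: it adds
  a vertex joined to two inner points of a chain. With it a pair turns into a pair and a single
  part, a single part into a pair, and the number of parts grows like the Fibonacci numbers. Since
  the rearrangement alters voltages and currents independently, demands are pairs of integers and
  not just ratios. Demands of one level stay within a constant factor of each other, because a large
  quotient h / r would cost an edge for every unit. The given ratio q / p is therefore first brought
  below 2 by series edges, the only source of the term q / p. Because a part has to fit anywhere in
  the plane, all networks are attached along a line; planarity then reduces to drawing one arc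
  between neighbouring points of that line.\<close>

definition joins :: "('v, 'e) multigraph \<Rightarrow> 'e set \<Rightarrow> 'v \<Rightarrow> 'v \<Rightarrow> bool" where
  "joins G F v w \<longleftrightarrow> (v, w) \<in> {(x, y). \<exists>e\<in>F. ends G e = {x, y}}\<^sup>*"

lemma joins_refl [simp]: "joins G F v v"
  by (simp add: joins_def)

lemma joins_trans: "joins G F u v \<Longrightarrow> joins G F v w \<Longrightarrow> joins G F u w"
  unfolding joins_def by (rule rtrancl_trans)

lemma joins_sym: "joins G F u v \<Longrightarrow> joins G F v u"
proof -
  have "sym {(x, y). \<exists>e\<in>F. ends G e = {x, y}}"
    by (auto simp: sym_def insert_commute)
  then show "joins G F u v \<Longrightarrow> joins G F v u"
    unfolding joins_def by (meson sym_rtrancl symD)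
qed

lemma joins_mono: "joins G F u v \<Longrightarrow> F \<subseteq> F' \<Longrightarrow> joins G F' u v"
  unfolding joins_def by (erule rev_subsetD, rule rtrancl_mono, blast)

lemma joins_edge: "e \<in> F \<Longrightarrow> ends G e = {u, v} \<Longrightarrow> joins G F u v"
  unfolding joins_def by blast

lemma joins_induct [consumes 1, case_names base step]:
  assumes "joins G F u w" and "P u"
    and "\<And>e x y. joins G F u x \<Longrightarrow> e \<in> F \<Longrightarrow> ends G e = {x, y} \<Longrightarrow> P x \<Longrightarrow> P y"
  shows "P w"
  using assms(1) unfolding joins_def
proof (induction rule: rtrancl_induct)
  case base
  then show ?case by (rule assms(2))
next
  case (step y z)
  then show ?case using assms(3) unfolding joins_def by blast
qed

lemma joins_insert:
  assumes "joins G (insert e F) u v" and e: "ends G e = {x, y}"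
  shows "joins G F u v \<or> joins G F u x \<and> joins G F y v \<or> joins G F u y \<and> joins G F x v"
  using assms(1)
proof (induction rule: joins_induct)
  case base
  then show ?case by simp
next
  case (step f z w)
  show ?case
  proof (cases "f \<in> F")
    case True
    then have "joins G F z w"
      using step by (blast intro: joins_edge)
    then show ?thesis
      using step.IH by (blast intro: joins_trans)
  next
    case False
    then have "{z, w} = {x, y}" using step e by auto
    then have "z = x \<and> w = y \<or> z = y \<and> w = x" by (auto simp: doubleton_eq_iff)
    then show ?thesis
      using step.IH by (auto intro: joins_sym joins_trans)
  qed
qed

lemma adj_rel_joins: "(v, w) \<in> (adj_rel G)\<^sup>* \<longleftrightarrow> joins G (edges G) v w"
  by (simp add: joins_def adj_rel_def)

lemma connected_graph_joins:
  "connected_graph G \<longleftrightarrow> verts G \<noteq> {} \<and> (\<forall>v\<in>verts G. \<forall>w\<in>verts G. joins G (edges G) v w)"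
  by (simp add: connected_graph_def adj_rel_joins)

lemma opposite_eq: "ends G e = {v, w} \<Longrightarrow> opposite G e v = w"
  unfolding opposite_def by (rule the_equality) (auto simp: doubleton_eq_iff)

section \<open>Maximum principle and uniqueness of the potential\<close>

context finite_multigraph
begin

lemma ends_opposite:
  assumes "e \<in> edges G" "v \<in> ends G e"
  shows "ends G e = {v, opposite G e v}" and "opposite G e v \<noteq> v" and "opposite G e v \<in> verts G"
proof -
  obtain x y where xy: "ends G e = {x, y}" "x \<noteq> y"
    using card_ends[OF assms(1)] by (auto simp: card_2_iff)
  then obtain w where w: "ends G e = {v, w}" "w \<noteq> v"
    using assms(2) by (auto simp: insert_commute)
  have "opposite G e v = w" using w(1) by (rule opposite_eq)
  then show "ends G e = {v, opposite G e v}" "opposite G e v \<noteq> v"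
    using w by auto
  then show "opposite G e v \<in> verts G"
    using ends_in_verts[OF assms(1)] by auto
qed

lemma outflow_cong:
  assumes "\<And>w. w \<in> verts G \<Longrightarrow> \<phi> w = \<psi> w" "v \<in> verts G"
  shows "outflow G \<phi> v = outflow G \<psi> v"
  unfolding outflow_def
  by (rule sum.cong) (use assms ends_opposite in auto)

lemma outflow_diff: "outflow G (\<lambda>w. \<phi> w - \<psi> w) v = outflow G \<phi> v - outflow G \<psi> v"
  unfolding outflow_def by (simp add: sum_subtractf[symmetric] algebra_simps)

lemma outflow_divide: "outflow G (\<lambda>w. \<phi> w / c) v = outflow G \<phi> v / c"
  unfolding outflow_def by (simp add: sum_divide_distrib diff_divide_distrib)

text \<open>Maximum principle. At a vertex other than a and b where \<psi> is maximal, the outflow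
  is a sum of nonnegative terms with value 0, so every neighbour is maximal too; a positive maximum
  would spread along a path to a, where \<psi> is 0.\<close>

lemma harmonic_le_zero:
  assumes con: "connected_graph G" and a: "a \<in> verts G" and "\<psi> a = 0" "\<psi> b = 0"
    and harm: "\<And>v. v \<in> verts G - {a, b} \<Longrightarrow> outflow G \<psi> v = 0" and v: "v \<in> verts G"
  shows "\<psi> v \<le> 0"
proof (rule ccontr)
  assume "\<not> \<psi> v \<le> 0"
  define M where "M = Max (\<psi> ` verts G)"
  have M_ge: "\<psi> w \<le> M" if "w \<in> verts G" for w
    unfolding M_def using that finite_verts by simp
  have "M > 0" using M_ge[OF v] \<open>\<not> \<psi> v \<le> 0\<close> by simp
  have "M \<in> \<psi> ` verts G" unfolding M_def using finite_verts v by (intro Max_in) auto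
  then obtain m where m: "m \<in> verts G" "\<psi> m = M" by auto
  have "joins G (edges G) m a"
    using con m(1) a by (simp add: connected_graph_joins)
  then have "a \<in> verts G \<and> \<psi> a = M"
  proof (induction rule: joins_induct)
    case base
    then show ?case using m by simp
  next
    case (step e x y)
    have x: "x \<in> verts G" "\<psi> x = M" using step by auto
    have "x \<noteq> a" "x \<noteq> b" using x \<open>M > 0\<close> assms(3,4) by auto
    then have "outflow G \<psi> x = 0" using harm x(1) by simp
    moreover have "finite {e. e \<in> edges G \<and> x \<in> ends G e}" using finite_edges by simp
    moreover have "0 \<le> \<psi> x - \<psi> (opposite G f x)" if "f \<in> edges G \<and> x \<in> ends G f" for f
      using that ends_opposite(3)[of f x] M_ge x by simp
    ultimately have "\<psi> x - \<psi> (opposite G e x) = 0"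
      using step sum_nonneg_eq_0_iff[of "{e. e \<in> edges G \<and> x \<in> ends G e}"
          "\<lambda>f. \<psi> x - \<psi> (opposite G f x)"]
      by (simp add: outflow_def)
    moreover have "opposite G e x = y" using step by (simp add: opposite_eq)
    ultimately show ?case
      using x step ends_in_verts by fastforce
  qed
  then show False using \<open>M > 0\<close> assms(3) by simp
qed

text \<open>The maximum principle for both differences of two potentials gives uniqueness, so the
  resistance may be read off from any potential at hand: a forest count or a constructed
  one.\<close>

lemma effective_resistance_eq:
  assumes con: "connected_graph G" and ab: "a \<in> verts G" "b \<in> verts G"
    and pot: "is_potential G a b \<phi>"
  shows "effective_resistance G a b = 1 / outflow G \<phi> a"
proof -
  let ?\<phi> = "restrict \<phi> (verts G)"
  have out: "outflow G ?\<phi> v = outflow G \<phi> v" if "v \<in> verts G" for v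
    using that by (intro outflow_cong) auto
  have ex: "?\<phi> \<in> extensional (verts G) \<and> is_potential G a b ?\<phi>"
    using pot ab out by (auto simp: is_potential_def)
  have uniq: "\<psi> = ?\<phi>" if \<psi>: "\<psi> \<in> extensional (verts G)" "is_potential G a b \<psi>" for \<psi>
  proof (rule extensionalityI)
    show "\<psi> \<in> extensional (verts G)" by fact
    show "?\<phi> \<in> extensional (verts G)" by simp
    fix v assume v: "v \<in> verts G"
    have le: "\<psi>\<^sub>1 v \<le> \<psi>\<^sub>2 v" if "is_potential G a b \<psi>\<^sub>1" "is_potential G a b \<psi>\<^sub>2" for \<psi>\<^sub>1 \<psi>\<^sub>2
      using harmonic_le_zero[OF con ab(1) _ _ _ v, where b = b and \<psi> = "\<lambda>w. \<psi>\<^sub>1 w - \<psi>\<^sub>2 w"] that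
      by (simp add: is_potential_def outflow_diff)
    show "\<psi> v = ?\<phi> v"
      using le[of \<psi> ?\<phi>] le[of ?\<phi> \<psi>] \<psi>(2) ex by (meson antisym)
  qed
  have "potential G a b = ?\<phi>"
    unfolding potential_def using ex uniq by (intro the_equality) auto
  then show ?thesis
    using out[OF ab(1)] by (simp add: effective_resistance_def)
qed

end

section \<open>Spanning trees and separating forests\<close>

definition forest :: "('v, 'e) multigraph \<Rightarrow> 'e set \<Rightarrow> bool" where
  "forest G F \<longleftrightarrow> F \<subseteq> edges G \<and> (\<forall>e\<in>F. \<forall>x y. ends G e = {x, y} \<longrightarrow> \<not> joins G (F - {e}) x y)"

definition spanning_trees :: "('v, 'e) multigraph \<Rightarrow> 'e set set" where
  "spanning_trees G = {T. forest G T \<and> (\<forall>v\<in>verts G. \<forall>w\<in>verts G. joins G T v w)}"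

definition separating_forests :: "('v, 'e) multigraph \<Rightarrow> 'v \<Rightarrow> 'v \<Rightarrow> 'e set set" where
  "separating_forests G a b =
     {F. forest G F \<and> \<not> joins G F a b \<and> (\<forall>v\<in>verts G. joins G F a v \<or> joins G F b v)}"

lemma forest_subset:
  assumes "forest G F" "F' \<subseteq> F"
  shows "forest G F'"
  unfolding forest_def
proof (intro conjI ballI allI impI notI)
  show "F' \<subseteq> edges G" using assms by (auto simp: forest_def)
  fix e x y assume e: "e \<in> F'" "ends G e = {x, y}" "joins G (F' - {e}) x y"
  have "joins G (F - {e}) x y" using assms(2) by (intro joins_mono[OF e(3)]) auto
  then show False using assms e by (auto simp: forest_def)
qed

text \<open>The edge is the first one on the path from u to x. The singleton form lets a sum of
  indicators over the edges at u be evaluated as 1.\<close>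

lemma tree_edge_towards:
  assumes T: "forest G T" and ux: "joins G T u x" "u \<noteq> x"
  shows "\<exists>e. {e \<in> T. u \<in> ends G e \<and> \<not> joins G (T - {e}) u x} = {e}"
proof -
  define T' where "T' = {f \<in> T. u \<notin> ends G f}"
  \<comment> \<open>The walk is cut at its last visit to u: \<open>e\<close> is the edge taken
    there, and from its other end the walk stays in \<open>T'\<close>, away from u.\<close>
  have "x \<noteq> u \<longrightarrow> (\<exists>e\<in>T. \<exists>w. ends G e = {u, w} \<and> joins G T' w x)"
    using ux(1)
  proof (induction rule: joins_induct)
    case base
    then show ?case by simp
  next
    case (step f y z)
    show ?case
    proof (cases "y = u \<or> z = u")
      case True
      then show ?thesis using step by (metis joins_refl)
    next
      case False
      then have "f \<in> T'" using step by (auto simp: T'_def)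
      then have "joins G T' y z" using step by (blast intro: joins_edge)
      then show ?thesis using step False by (meson joins_trans)
    qed
  qed
  then obtain e w where e: "e \<in> T" "ends G e = {u, w}" "joins G T' w x"
    using ux(2) by auto
  have "\<not> joins G (T - {e}) u x"
  proof
    assume "joins G (T - {e}) u x"
    moreover have "joins G (T - {e}) w x"
      using e by (intro joins_mono[OF e(3)]) (auto simp: T'_def)
    ultimately have "joins G (T - {e}) u w" by (blast intro: joins_trans joins_sym)
    then show False using T e by (auto simp: forest_def)
  qed
  moreover have "joins G (T - {f}) u x" if "f \<in> T" "u \<in> ends G f" "f \<noteq> e" for f
  proof -
    have "joins G (T - {f}) u w" using that e by (intro joins_edge[of e]) auto
    moreover have "joins G (T - {f}) w x"
      using that by (intro joins_mono[OF e(3)]) (auto simp: T'_def)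
    ultimately show ?thesis by (rule joins_trans)
  qed
  ultimately have "{e \<in> T. u \<in> ends G e \<and> \<not> joins G (T - {e}) u x} = {e}"
    using e by auto
  then show ?thesis by blast
qed

context finite_multigraph
begin

text \<open>A cycle through an old edge f after the insertion would have to use e; as the ends of f
  are joined in F, x and y would be joined in F as well, although F separates them.\<close>

lemma insert_crossing_edge:
  assumes F: "F \<in> separating_forests G a b" and e: "e \<in> edges G" "ends G e = {x, y}"
    and ax: "joins G F a x" and hby: "joins G F b y"
  shows "e \<notin> F" and "insert e F \<in> spanning_trees G"
proof -
  have nab: "\<not> joins G F a b" and F': "forest G F"
    using F by (auto simp: separating_forests_def)
  have nxy: "\<not> joins G F x y"
    using nab joins_trans[OF joins_trans[OF ax] joins_sym[OF hby]] by blast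
  then show eF: "e \<notin> F" using e by (meson joins_edge)
  have toa: "joins G (insert e F) a v" if "v \<in> verts G" for v
  proof -
    have "joins G (insert e F) x y" using e by (intro joins_edge[of e]) auto
    moreover have "joins G (insert e F) a x" "joins G (insert e F) y b"
      using ax joins_sym[OF hby] by (blast intro: joins_mono)+
    ultimately have "joins G (insert e F) a b"
      by (metis joins_trans)
    moreover have "joins G F a v \<or> joins G F b v"
      using F that by (auto simp: separating_forests_def)
    then have "joins G (insert e F) a v \<or> joins G (insert e F) b v"
      by (blast intro: joins_mono)
    ultimately show ?thesis
      by (metis joins_trans)
  qed
  have "forest G (insert e F)"
    unfolding forest_def
  proof (intro conjI ballI allI impI)
    show "insert e F \<subseteq> edges G" using F' e by (auto simp: forest_def)
    fix f z w assume f: "f \<in> insert e F" "ends G f = {z, w}"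
    show "\<not> joins G (insert e F - {f}) z w"
    proof (cases "f = e")
      case True
      then have "{z, w} = {x, y}" using f e by simp
      then have "\<not> joins G F z w" using nxy by (auto simp: doubleton_eq_iff dest: joins_sym)
      then show ?thesis using True eF by simp
    next
      case False
      then have fF: "f \<in> F" using f by simp
      have zw: "joins G F z w" using fF f by (meson joins_edge)
      show ?thesis
      proof
        assume "joins G (insert e F - {f}) z w"
        then have "joins G (insert e (F - {f})) z w" using False by (simp add: insert_Diff_if)
        from joins_insert[OF this e(2)] have
          "joins G (F - {f}) z w \<or> joins G F z x \<and> joins G F y w \<or> joins G F z y \<and> joins G F x w"
          using joins_mono[of G "F - {f}" _ _ F] by blast
        moreover have "\<not> joins G (F - {f}) z w" using F' fF f by (auto simp: forest_def)
        ultimately consider "joins G F z x" "joins G F y w" | "joins G F z y" "joins G F x w" by blast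
        then have "joins G F x y"
        proof cases
          case 1
          then show ?thesis using joins_trans[OF joins_trans[OF joins_sym[OF 1(1)] zw] joins_sym[OF 1(2)]] by simp
        next
          case 2
          then show ?thesis using joins_trans[OF joins_trans[OF 2(2) joins_sym[OF zw]] 2(1)] by simp
        qed
        then show False using nxy by simp
      qed
    qed
  qed
  then show "insert e F \<in> spanning_trees G"
    using joins_trans[OF joins_sym[OF toa] toa] by (simp add: spanning_trees_def)
qed

lemma remove_separating_edge:
  assumes T: "T \<in> spanning_trees G" and ab: "a \<in> verts G" "b \<in> verts G"
    and e: "e \<in> T" and nab: "\<not> joins G (T - {e}) a b"
  shows "T - {e} \<in> separating_forests G a b"
proof -
  have eE: "e \<in> edges G" using T e by (auto simp: spanning_trees_def forest_def)
  obtain x y where xy: "ends G e = {x, y}"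
    using card_ends[OF eE] by (auto simp: card_2_iff)
  have ins: "insert e (T - {e}) = T" using e by auto
  have av: "joins G T a v" if "v \<in> verts G" for v
    using T ab that by (auto simp: spanning_trees_def)
  have split: "joins G (T - {e}) a v \<or> joins G (T - {e}) a x \<and> joins G (T - {e}) y v
      \<or> joins G (T - {e}) a y \<and> joins G (T - {e}) x v" if "v \<in> verts G" for v
    using joins_insert[of G e "T - {e}" a v x y] av[OF that] ins xy by simp
  have "joins G (T - {e}) a v \<or> joins G (T - {e}) b v" if "v \<in> verts G" for v
  proof -
    consider "joins G (T - {e}) a x" "joins G (T - {e}) y b" | "joins G (T - {e}) a y" "joins G (T - {e}) x b"
      using split[OF ab(2)] nab by blast
    then show ?thesis
    proof cases
      case 1
      then show ?thesis
        using split[OF that] nab joins_trans[OF joins_sym[OF 1(2)], of v] joins_trans[OF _ 1(2), of a] by blast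
    next
      case 2
      then show ?thesis
        using split[OF that] nab joins_trans[OF joins_sym[OF 2(2)], of v] joins_trans[OF _ 2(2), of a] by blast
    qed
  qed
  then show ?thesis
    using T nab by (auto simp: separating_forests_def spanning_trees_def intro: forest_subset)
qed

lemma finite_spanning_trees: "finite (spanning_trees G)"
  using finite_edges by (rule finite_subset[rotated, OF finite_Pow_iff[THEN iffD2]])
    (auto simp: spanning_trees_def forest_def)

lemma separating_forests_subset_Pow: "separating_forests G a b \<subseteq> Pow (edges G)"
  by (auto simp: separating_forests_def forest_def)

lemma finite_separating_forests: "finite (separating_forests G a b)"
  by (rule finite_subset[OF separating_forests_subset_Pow]) (simp add: finite_edges)

lemma spanning_trees_nonempty:
  assumes "connected_graph G"
  shows "spanning_trees G \<noteq> {}"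
proof -
  define \<T> where "\<T> = {T. T \<subseteq> edges G \<and> (\<forall>v\<in>verts G. \<forall>w\<in>verts G. joins G T v w)}"
  have "finite \<T>"
    by (rule finite_subset[of _ "Pow (edges G)"]) (auto simp: \<T>_def finite_edges)
  moreover have "edges G \<in> \<T>"
    using assms by (auto simp: \<T>_def connected_graph_joins)
  ultimately have "\<exists>T\<in>\<T>. \<forall>T'\<in>\<T>. T' \<subseteq> T \<longrightarrow> T = T'"
    by (metis finite_has_minimal empty_iff)
  then obtain T where T: "T \<in> \<T>" and min: "\<And>T'. T' \<in> \<T> \<Longrightarrow> T' \<subseteq> T \<Longrightarrow> T = T'"
    by blast
  have "forest G T"
    unfolding forest_def
  proof (intro conjI ballI allI impI notI)
    show "T \<subseteq> edges G" using T by (simp add: \<T>_def)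
    fix e x y assume e: "e \<in> T" "ends G e = {x, y}" "joins G (T - {e}) x y"
    have "joins G (T - {e}) v w" if "v \<in> verts G" "w \<in> verts G" for v w
    proof -
      have "joins G (insert e (T - {e})) v w"
        using T that e by (simp add: \<T>_def insert_absorb)
      then consider "joins G (T - {e}) v w" | "joins G (T - {e}) v x" "joins G (T - {e}) y w"
        | "joins G (T - {e}) v y" "joins G (T - {e}) x w"
        using joins_insert[OF _ e(2)] by blast
      then show ?thesis
      proof cases
        case 2
        then show ?thesis using joins_trans[OF joins_trans[OF 2(1) e(3)] 2(2)] by simp
      next
        case 3
        then show ?thesis using joins_trans[OF joins_trans[OF 3(1) joins_sym[OF e(3)]] 3(2)] by simp
      qed simp
    qed
    then have "T - {e} \<in> \<T>" using T by (auto simp: \<T>_def)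
    then show False using min[of "T - {e}"] e by auto
  qed
  then show ?thesis using T by (auto simp: spanning_trees_def \<T>_def)
qed

lemma separating_forests_nonempty:
  assumes "connected_graph G" "a \<in> verts G" "b \<in> verts G" "a \<noteq> b"
  shows "separating_forests G a b \<noteq> {}"
proof -
  obtain T where T: "T \<in> spanning_trees G"
    using spanning_trees_nonempty[OF assms(1)] by blast
  then have "joins G T a b" "forest G T" using assms by (auto simp: spanning_trees_def)
  then obtain e where "{e \<in> T. a \<in> ends G e \<and> \<not> joins G (T - {e}) a b} = {e}"
    using tree_edge_towards[OF _ _ assms(4)] by blast
  then have "e \<in> T" "\<not> joins G (T - {e}) a b" by auto
  then show ?thesis using remove_separating_edge[OF T assms(2,3)] by blast
qed

lemma crossing_edge_exists:
  assumes con: "connected_graph G" and ab: "a \<in> verts G" "b \<in> verts G"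
    and F: "F \<in> separating_forests G a b"
  obtains e x y where "e \<in> edges G" "ends G e = {x, y}" "joins G F a x" "joins G F b y"
proof (rule ccontr)
  assume neg: "\<not> thesis"
  have "joins G (edges G) a b" using con ab by (simp add: connected_graph_joins)
  then have "joins G F a b"
  proof (induction rule: joins_induct)
    case base
    then show ?case by simp
  next
    case (step e x y)
    then have "y \<in> verts G" using ends_in_verts[of e] by auto
    then have "joins G F a y \<or> joins G F b y" using F by (auto simp: separating_forests_def)
    then show ?case using neg that step by blast
  qed
  then show False using F by (simp add: separating_forests_def)
qed

text \<open>For each F choose an edge e of G between its two sides. The pair of e and the tree
  \<open>insert e F\<close> determines F, because e is not in F.\<close>

lemma card_separating_forests_le:
  assumes con: "connected_graph G" and ab: "a \<in> verts G" "b \<in> verts G"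
  shows "card (separating_forests G a b) \<le> card (edges G) * card (spanning_trees G)"
proof -
  have "\<exists>e. e \<in> edges G \<and> e \<notin> F \<and> insert e F \<in> spanning_trees G"
    if F: "F \<in> separating_forests G a b" for F
  proof -
    obtain e x y where "e \<in> edges G" "ends G e = {x, y}" "joins G F a x" "joins G F b y"
      using crossing_edge_exists[OF con ab F] .
    then show ?thesis using insert_crossing_edge[OF F] by blast
  qed
  then obtain f where f: "\<And>F. F \<in> separating_forests G a b \<Longrightarrow>
      f F \<in> edges G \<and> f F \<notin> F \<and> insert (f F) F \<in> spanning_trees G"
    by metis
  have "inj_on (\<lambda>F. (f F, insert (f F) F)) (separating_forests G a b)"
  proof (rule inj_onI)
    fix F F' assume *: "F \<in> separating_forests G a b" "F' \<in> separating_forests G a b"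
      "(f F, insert (f F) F) = (f F', insert (f F') F')"
    then have "insert (f F) F = insert (f F) F'" "f F \<notin> F" "f F \<notin> F'"
      using f[of F] f[of F'] by auto
    then show "F = F'" by (simp add: insert_ident)
  qed
  moreover have "(\<lambda>F. (f F, insert (f F) F)) ` separating_forests G a b \<subseteq> edges G \<times> spanning_trees G"
    using f by auto
  ultimately have "card (separating_forests G a b) \<le> card (edges G \<times> spanning_trees G)"
    using finite_edges finite_spanning_trees by (intro card_inj_on_le) auto
  then show ?thesis by (simp add: card_cartesian_product)
qed

text \<open>Adding a crossing edge to a separating forest gives a tree, and every tree in which the edge
  separates \<open>a\<close> from \<open>b\<close> arises in this way. For a fixed tree, the edges at \<open>u\<close> contribute the
  unit flow along its path from \<open>a\<close> to \<open>b\<close>.\<close>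

lemma outflow_forest_count:
  assumes ab: "a \<in> verts G" "b \<in> verts G" "a \<noteq> b" and u: "u \<in> verts G"
  defines "\<phi> \<equiv> \<lambda>v. \<Sum>F\<in>separating_forests G a b. of_bool (joins G F a v) :: real"
  shows "outflow G \<phi> u = real (card (spanning_trees G)) * (of_bool (u = a) - of_bool (u = b))"
proof -
  let ?S = "separating_forests G a b" and ?T = "spanning_trees G"
  define I where "I = {e. e \<in> edges G \<and> u \<in> ends G e}"
  define t where "t = (\<lambda>F e. of_bool (joins G F a u) - of_bool (joins G F a (opposite G e u)) :: real)"
  \<comment> \<open>For pairs in \<open>X\<close> the two ends of e lie on different sides, so
    \<open>t\<close> can be rewritten as \<open>s\<close>, which mentions only u and the tree. If
    removing e leaves a and b joined, both terms of \<open>s\<close> agree; hence the sum extends to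
    all tree edges at u, and \<open>tree_edge_towards\<close> evaluates each term.\<close>
  define s where "s = (\<lambda>T e. of_bool (\<not> joins G (T - {e}) u b) - of_bool (\<not> joins G (T - {e}) u a) :: real)"
  define X where "X = {(F, e). F \<in> ?S \<and> e \<in> I \<and> t F e \<noteq> 0}"
  define Y where "Y = {(T, e). T \<in> ?T \<and> e \<in> I \<and> e \<in> T \<and> \<not> joins G (T - {e}) a b}"
  have finI: "finite I" using finite_edges by (simp add: I_def)
  note fin = finite_separating_forests[of a b] finite_spanning_trees finI
  have side: "joins G F b v \<longleftrightarrow> \<not> joins G F a v" if "F \<in> ?S" "v \<in> verts G" for F v
  proof -
    have "\<not> joins G F a b" "joins G F a v \<or> joins G F b v"
      using that by (auto simp: separating_forests_def)
    then show ?thesis by (meson joins_sym joins_trans)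
  qed
  have crossing: "\<exists>x y. ends G e = {x, y} \<and> joins G F a x \<and> joins G F b y" if "(F, e) \<in> X" for F e
  proof -
    have e: "e \<in> edges G" "u \<in> ends G e" and F: "F \<in> ?S" and "t F e \<noteq> 0"
      using that by (auto simp: X_def I_def)
    then have "joins G F a u \<noteq> joins G F a (opposite G e u)" by (auto simp: t_def)
    then consider "joins G F a u" "joins G F b (opposite G e u)"
      | "joins G F a (opposite G e u)" "joins G F b u"
      using ends_opposite(3)[OF e] side[OF F] u by blast
    then show ?thesis
      using ends_opposite(1)[OF e] by cases (auto simp: doubleton_eq_iff)
  qed
  have "outflow G \<phi> u = (\<Sum>e\<in>I. \<Sum>F\<in>?S. t F e)"
    by (simp add: outflow_def \<phi>_def I_def t_def sum_subtractf)
  also have "\<dots> = (\<Sum>F\<in>?S. \<Sum>e\<in>I. t F e)" by (rule sum.swap)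
  also have "\<dots> = (\<Sum>(F, e)\<in>?S \<times> I. t F e)" by (rule sum.cartesian_product)
  also have "\<dots> = (\<Sum>(F, e)\<in>X. t F e)"
    by (rule sum.mono_neutral_right) (use fin in \<open>auto simp: X_def\<close>)
  also have "\<dots> = (\<Sum>(T, e)\<in>Y. s T e)"
  proof (rule sum.reindex_bij_witness[where i = "\<lambda>(T, e). (T - {e}, e)" and j = "\<lambda>(F, e). (insert e F, e)"])
    fix z assume z: "z \<in> X"
    obtain F e where Fe: "z = (F, e)" by force
    have F: "F \<in> ?S" and e: "e \<in> edges G" "u \<in> ends G e"
      using z Fe by (auto simp: X_def I_def)
    obtain x y where xy: "ends G e = {x, y}" "joins G F a x" "joins G F b y"
      using crossing z Fe by blast
    note ins = insert_crossing_edge[OF F e(1) xy]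
    show "(case case z of (F, e) \<Rightarrow> (insert e F, e) of (T, e) \<Rightarrow> (T - {e}, e)) = z"
      using Fe ins by simp
    show "(case z of (F, e) \<Rightarrow> (insert e F, e)) \<in> Y"
      using Fe ins z F by (auto simp: Y_def X_def separating_forests_def)
    have "opposite G e u \<in> verts G" "joins G F a u \<noteq> joins G F a (opposite G e u)"
      using z Fe ends_opposite[OF e] by (auto simp: X_def t_def)
    then have "t F e = s (insert e F) e"
      using side[OF F u] ins(1) by (auto simp: t_def s_def dest: joins_sym)
    then show "(case case z of (F, e) \<Rightarrow> (insert e F, e) of (T, e) \<Rightarrow> s T e) = (case z of (F, e) \<Rightarrow> t F e)"
      using Fe by simp
  next
    fix z assume z: "z \<in> Y"
    obtain T e where Te: "z = (T, e)" by force
    have T: "T \<in> ?T" "e \<in> T" "\<not> joins G (T - {e}) a b" and e: "e \<in> edges G" "u \<in> ends G e"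
      using z Te by (auto simp: Y_def I_def)
    have F: "T - {e} \<in> ?S" using remove_separating_edge[OF T(1) ab(1,2) T(2,3)] .
    show "(case case z of (T, e) \<Rightarrow> (T - {e}, e) of (F, e) \<Rightarrow> (insert e F, e)) = z"
      using Te T by auto
    have "\<not> joins G (T - {e}) u (opposite G e u)"
      using T ends_opposite(1)[OF e] by (auto simp: spanning_trees_def forest_def)
    then have "joins G (T - {e}) a u \<noteq> joins G (T - {e}) a (opposite G e u)"
      using side[OF F u] side[OF F ends_opposite(3)[OF e]] by (meson joins_trans joins_sym)
    then show "(case z of (T, e) \<Rightarrow> (T - {e}, e)) \<in> X"
      using Te F e by (auto simp: X_def t_def I_def)
  qed
  also have "\<dots> = (\<Sum>(T, e)\<in>Sigma ?T (\<lambda>T. {e \<in> I. e \<in> T}). s T e)"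
  proof (rule sum.mono_neutral_left)
    show "finite (Sigma ?T (\<lambda>T. {e \<in> I. e \<in> T}))" using fin by auto
    show "Y \<subseteq> Sigma ?T (\<lambda>T. {e \<in> I. e \<in> T})" by (auto simp: Y_def)
    show "\<forall>z\<in>Sigma ?T (\<lambda>T. {e \<in> I. e \<in> T}) - Y. (case z of (T, e) \<Rightarrow> s T e) = 0"
    proof
      fix z assume z: "z \<in> Sigma ?T (\<lambda>T. {e \<in> I. e \<in> T}) - Y"
      obtain T e where Te: "z = (T, e)" by force
      then have "joins G (T - {e}) a b" using z by (auto simp: Y_def)
      then have "joins G (T - {e}) u a \<longleftrightarrow> joins G (T - {e}) u b"
        by (meson joins_trans joins_sym)
      then show "(case z of (T, e) \<Rightarrow> s T e) = 0" using Te by (simp add: s_def)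
    qed
  qed
  also have "\<dots> = (\<Sum>T\<in>?T. \<Sum>e | e \<in> I \<and> e \<in> T. s T e)"
    using fin by (subst sum.Sigma) auto
  also have "\<dots> = (\<Sum>T\<in>?T. of_bool (u \<noteq> b) - of_bool (u \<noteq> a))"
  proof (rule sum.cong)
    fix T assume T: "T \<in> ?T"
    have count: "(\<Sum>e | e \<in> I \<and> e \<in> T. of_bool (\<not> joins G (T - {e}) u x)) = (of_bool (u \<noteq> x) :: real)"
      if x: "x \<in> verts G" for x
    proof (cases "u = x")
      case False
      have "joins G T u x" "forest G T" using T u x by (auto simp: spanning_trees_def)
      then obtain e where e: "{e \<in> T. u \<in> ends G e \<and> \<not> joins G (T - {e}) u x} = {e}"
        using tree_edge_towards[OF _ _ False] by blast
      have "{e. (e \<in> I \<and> e \<in> T) \<and> \<not> joins G (T - {e}) u x} = {e}"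
        using T unfolding e[symmetric] by (auto simp: I_def spanning_trees_def forest_def)
      moreover have "finite {e. e \<in> I \<and> e \<in> T}" using finI by simp
      ultimately show ?thesis using False by (simp add: Int_def)
    qed simp
    show "(\<Sum>e | e \<in> I \<and> e \<in> T. s T e) = of_bool (u \<noteq> b) - of_bool (u \<noteq> a)"
      unfolding s_def sum_subtractf using count ab by simp
  qed simp
  also have "\<dots> = real (card ?T) * (of_bool (u = a) - of_bool (u = b))"
    using ab(3) by (auto simp: algebra_simps)
  finally show ?thesis .
qed

theorem effective_resistance_forest_count:
  assumes con: "connected_graph G" and ab: "a \<in> verts G" "b \<in> verts G" "a \<noteq> b"
  shows "effective_resistance G a b =
    real (card (separating_forests G a b)) / real (card (spanning_trees G))"
proof -
  let ?n = "real (card (separating_forests G a b))"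
  define \<phi> where "\<phi> = (\<lambda>v. (\<Sum>F\<in>separating_forests G a b. of_bool (joins G F a v)) :: real)"
  have pos: "?n > 0"
    using separating_forests_nonempty[OF con ab] finite_separating_forests by (simp add: card_gt_0_iff)
  have "\<phi> a = ?n" by (simp add: \<phi>_def)
  moreover have "\<phi> b = 0" by (auto simp: \<phi>_def separating_forests_def)
  ultimately have "is_potential G a b (\<lambda>v. \<phi> v / ?n)"
    using pos ab by (auto simp: is_potential_def outflow_divide outflow_forest_count[OF ab, folded \<phi>_def])
  then show ?thesis
    using ab by (simp add: effective_resistance_eq[OF con ab(1,2)] outflow_divide
      outflow_forest_count[OF ab, folded \<phi>_def])
qed

theorem edges_lower_bound:
  fixes p q :: nat
  assumes con: "connected_graph G" and ab: "a \<in> verts G" "b \<in> verts G" "a \<noteq> b"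
    and pq: "0 < p" "0 < q" "coprime p q" and res: "effective_resistance G a b = real q / real p"
  shows "max (real q / real p) (log 2 (real q)) \<le> real (card (edges G))"
proof -
  let ?S = "card (separating_forests G a b)" and ?T = "card (spanning_trees G)"
  have S: "?S > 0"
    using separating_forests_nonempty[OF con ab] finite_separating_forests by (simp add: card_gt_0_iff)
  have le: "?S \<le> card (edges G) * ?T" using card_separating_forests_le[OF con ab(1,2)] .
  have T: "?T > 0" using S le by (cases "?T = 0") auto
  have "real q / real p = real ?S / real ?T"
    using res effective_resistance_forest_count[OF con ab] by simp
  then have "real (q * ?T) = real (?S * p)" using T pq by (simp add: field_simps)
  then have "q * ?T = ?S * p" by (simp only: of_nat_eq_iff)
  \<comment> \<open>Lowest terms enter here: the numerator divides the forest count and inherits its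
    bound.\<close>
  then have "q dvd ?S"
    using pq(3) coprime_dvd_mult_left_iff[of q p ?S] dvd_triv_left[of q ?T] by (simp add: coprime_commute)
  then have "q \<le> ?S" using S by (simp add: dvd_imp_le)
  also have "?S \<le> card (Pow (edges G))"
    using separating_forests_subset_Pow finite_edges by (intro card_mono) auto
  also have "\<dots> = 2 ^ card (edges G)" by (simp add: card_Pow finite_edges)
  finally have "log 2 (real q) \<le> real (card (edges G))" using pq by (intro log2_of_power_le) auto
  moreover have "real ?S \<le> real (card (edges G) * ?T)" using le by (simp only: of_nat_le_iff)
  then have "real ?S / real ?T \<le> real (card (edges G))" using T by (simp add: field_simps)
  ultimately show ?thesis
    using \<open>real q / real p = real ?S / real ?T\<close> by simp
qed

end

section \<open>Plane networks with terminals on a line\<close>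

definition drawing ::
  "('v, 'e) multigraph \<Rightarrow> ('v \<Rightarrow> real \<times> real) \<Rightarrow> ('e \<Rightarrow> real \<Rightarrow> real \<times> real) \<Rightarrow> (real \<times> real) set" where
  "drawing G pos \<gamma> = pos ` verts G \<union> (\<Union>e\<in>edges G. path_image (\<gamma> e))"

lemma plane_drawing_comp:
  fixes h :: "real \<times> real \<Rightarrow> real \<times> real"
  assumes D: "plane_drawing G pos \<gamma>" and h: "inj h" "continuous_on UNIV h"
  shows "plane_drawing G (h \<circ> pos) (\<lambda>e. h \<circ> \<gamma> e)"
proof -
  have hi: "(h \<circ> pos) ` A = h ` (pos ` A)" for A by (simp add: image_comp)
  show ?thesis
    unfolding plane_drawing_def
  proof (intro conjI ballI impI)
    show "inj_on (h \<circ> pos) (verts G)"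
      using D h(1) by (auto simp: plane_drawing_def intro: comp_inj_on inj_on_subset)
    fix e assume e: "e \<in> edges G"
    have *: "arc (\<gamma> e)" "{pathstart (\<gamma> e), pathfinish (\<gamma> e)} = pos ` ends G e"
      "path_image (\<gamma> e) \<inter> pos ` verts G = pos ` ends G e"
      using D e by (auto simp: plane_drawing_def)
    have "path (h \<circ> \<gamma> e)"
      using *(1) continuous_on_subset[OF h(2) subset_UNIV] by (intro path_continuous_image) (auto simp: arc_def)
    moreover have "inj_on (h \<circ> \<gamma> e) {0..1}"
      using *(1) inj_on_subset[OF h(1) subset_UNIV] by (intro comp_inj_on) (auto simp: arc_def)
    ultimately show "arc (h \<circ> \<gamma> e)" by (simp add: arc_def)
    have "{pathstart (h \<circ> \<gamma> e), pathfinish (h \<circ> \<gamma> e)} = h ` {pathstart (\<gamma> e), pathfinish (\<gamma> e)}"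
      by (simp add: pathstart_def pathfinish_def)
    then show "{pathstart (h \<circ> \<gamma> e), pathfinish (h \<circ> \<gamma> e)} = (h \<circ> pos) ` ends G e"
      using *(2) by (simp add: image_comp)
    show "path_image (h \<circ> \<gamma> e) \<inter> (h \<circ> pos) ` verts G = (h \<circ> pos) ` ends G e"
      unfolding hi path_image_compose image_Int[OF h(1), symmetric] *(3) ..
    fix f assume f: "f \<in> edges G" "e \<noteq> f"
    have **: "path_image (\<gamma> e) \<inter> path_image (\<gamma> f) = pos ` (ends G e \<inter> ends G f)"
      using D e f by (auto simp: plane_drawing_def)
    show "path_image (h \<circ> \<gamma> e) \<inter> path_image (h \<circ> \<gamma> f) = (h \<circ> pos) ` (ends G e \<inter> ends G f)"
      unfolding hi path_image_compose image_Int[OF h(1), symmetric] ** ..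
  qed
qed

text \<open>Makes room for new arcs. Shifting left by the distance of the height from H pulls the
  drawing off the boundary line except at heights in H, where nothing moves. Heights are preserved,
  so the map is injective.\<close>

lemma shear_drawing:
  assumes D: "plane_drawing G pos \<gamma>" and le: "\<And>z. z \<in> drawing G pos \<gamma> \<Longrightarrow> fst z \<le> 0"
  obtains pos' \<gamma>' where "plane_drawing G pos' \<gamma>'"
    "\<And>v. pos' v = (fst (pos v) - infdist (snd (pos v)) H, snd (pos v))"
    "\<And>z. z \<in> drawing G pos' \<gamma>' \<Longrightarrow> fst z \<le> - infdist (snd z) H"
proof
  define h where "h = (\<lambda>z :: real \<times> real. (fst z - infdist (snd z) H, snd z))"
  have "inj h" by (auto simp: inj_def h_def prod_eq_iff)
  moreover have "continuous_on UNIV h"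
    unfolding h_def by (intro continuous_intros)
  ultimately show "plane_drawing G (h \<circ> pos) (\<lambda>e. h \<circ> \<gamma> e)"
    by (rule plane_drawing_comp[OF D])
  show "(h \<circ> pos) v = (fst (pos v) - infdist (snd (pos v)) H, snd (pos v))" for v
    by (simp add: h_def)
  fix z assume "z \<in> drawing G (h \<circ> pos) (\<lambda>e. h \<circ> \<gamma> e)"
  then have "z \<in> h ` drawing G pos \<gamma>"
    by (auto simp: drawing_def path_image_compose)
  then show "fst z \<le> - infdist (snd z) H" using le by (auto simp: h_def)
qed

text \<open>The arc keeps half the distance \<open>infdist _ H'\<close> from the line, while D keeps
  at least the full distance. They can meet only at heights in \<open>H'\<close>, which on this
  segment are its two ends. \<open>H'\<close> may be larger than H because the far end may be the
  place of a new vertex.\<close>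

lemma arc_in_gap:
  fixes y1 y2 :: real
  assumes H: "finite H" "y1 \<in> H" "H \<subseteq> H'" "finite H'" "y2 \<in> H'" "y1 \<noteq> y2"
    and gap: "H' \<inter> closed_segment y1 y2 = {y1, y2}"
    and le: "\<And>z. z \<in> D \<Longrightarrow> fst z \<le> - infdist (snd z) H"
  obtains \<alpha> where "arc \<alpha>" "pathstart \<alpha> = (0, y1)" "pathfinish \<alpha> = (0, y2)"
    "path_image \<alpha> \<inter> D \<subseteq> {(0, y1), (0, y2)}" "\<And>z. z \<in> path_image \<alpha> \<Longrightarrow> fst z \<le> 0"
proof
  define l where "l = linepath y1 y2"
  define \<alpha> where "\<alpha> = (\<lambda>t. (- infdist (l t) H' / 2, l t))"
  have "inj_on l {0..1}" unfolding l_def using H(6) by (simp add: arc_linepath arc_imp_inj_on)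
  then have "inj_on \<alpha> {0..1}" by (auto simp: inj_on_def \<alpha>_def)
  moreover have "continuous_on {0..1} l"
    unfolding l_def by (rule continuous_on_linepath)
  then have "path \<alpha>" unfolding path_def \<alpha>_def by (intro continuous_intros) auto
  ultimately show "arc \<alpha>" by (simp add: arc_def)
  show "pathstart \<alpha> = (0, y1)" "pathfinish \<alpha> = (0, y2)"
    using H by (auto simp: \<alpha>_def l_def pathstart_def pathfinish_def linepath_def)
  have im: "snd z \<in> closed_segment y1 y2 \<and> fst z = - infdist (snd z) H' / 2" if "z \<in> path_image \<alpha>" for z
    using that linepath_image_01[of y1 y2] by (auto simp: path_image_def \<alpha>_def l_def)
  show "fst z \<le> 0" if "z \<in> path_image \<alpha>" for z
    using im[OF that] infdist_nonneg[of "snd z" H'] by simp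
  show "path_image \<alpha> \<inter> D \<subseteq> {(0, y1), (0, y2)}"
  proof
    fix z assume z: "z \<in> path_image \<alpha> \<inter> D"
    have "infdist (snd z) H' \<le> infdist (snd z) H"
      using H by (intro infdist_mono) auto
    then have "infdist (snd z) H' = 0"
      using im[of z] le[of z] z infdist_nonneg[of "snd z" H] infdist_nonneg[of "snd z" H'] by auto
    then have "snd z \<in> H'"
      using in_closed_iff_infdist_zero[of H' "snd z"] H finite_imp_closed by auto
    then have "snd z \<in> {y1, y2}" using im[of z] z gap by blast
    then show "z \<in> {(0, y1), (0, y2)}"
      using im[of z] z \<open>infdist (snd z) H' = 0\<close> by (auto simp: prod_eq_iff)
  qed
qed

section \<open>Adding an edge to a graph and to its drawing\<close>

definition add_edge :: "('v, 'e) multigraph \<Rightarrow> 'e \<Rightarrow> 'v \<Rightarrow> 'v \<Rightarrow> ('v, 'e) multigraph" where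
  "add_edge G e a b =
     \<lparr>verts = insert a (insert b (verts G)), edges = insert e (edges G), ends = (ends G)(e := {a, b})\<rparr>"

lemma add_edge_simps [simp]:
  "verts (add_edge G e a b) = insert a (insert b (verts G))"
  "edges (add_edge G e a b) = insert e (edges G)"
  "ends (add_edge G e a b) = (ends G)(e := {a, b})"
  by (simp_all add: add_edge_def)

lemma finite_multigraph_add_edge:
  assumes "finite_multigraph G" "e \<notin> edges G" "a \<noteq> b"
  shows "finite_multigraph (add_edge G e a b)"
proof -
  interpret finite_multigraph G by fact
  show ?thesis
    using assms finite_verts finite_edges ends_in_verts card_ends
    by unfold_locales (auto simp: subset_insertI2)
qed

lemma connected_graph_add_edge:
  assumes con: "connected_graph G" and e: "e \<notin> edges G" and a: "a \<in> verts G"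
  shows "connected_graph (add_edge G e a b)"
proof -
  let ?G = "add_edge G e a b"
  have old: "joins ?G (edges ?G) v w" if "joins G (edges G) v w" for v w
    using that
  proof (induction rule: joins_induct)
    case base
    then show ?case by simp
  next
    case (step f x y)
    then have "joins ?G (edges ?G) x y"
      using e by (intro joins_edge[of f]) auto
    then show ?case using step.IH by (rule joins_trans[rotated])
  qed
  have "joins ?G (edges ?G) a v" if "v \<in> verts ?G" for v
  proof (cases "v \<in> verts G")
    case True
    then show ?thesis using con a old by (auto simp: connected_graph_joins)
  next
    case False
    then have "v = b" using that a by auto
    then show ?thesis by (intro joins_edge[of e]) auto
  qed
  then have "joins ?G (edges ?G) v w" if "v \<in> verts ?G" "w \<in> verts ?G" for v w
    using that joins_trans[OF joins_sym] by metis
  then show ?thesis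
    unfolding connected_graph_joins by simp
qed

lemma outflow_add_edge:
  assumes G: "finite_multigraph G" and e: "e \<notin> edges G" and ab: "a \<noteq> b"
  shows "outflow (add_edge G e a b) \<phi> v =
    outflow G \<phi> v + (if v = a then \<phi> a - \<phi> b else if v = b then \<phi> b - \<phi> a else 0)"
proof -
  interpret finite_multigraph G by fact
  let ?G = "add_edge G e a b" and ?A = "{f. f \<in> edges G \<and> v \<in> ends G f}"
  have ne: "f \<noteq> e" if "f \<in> edges G" for f using that e by auto
  have opp: "opposite ?G f v = opposite G f v" if "f \<in> edges G" for f
    using ne[OF that] by (simp add: opposite_def)
  have set: "{f. f \<in> edges ?G \<and> v \<in> ends ?G f} = (if v \<in> {a, b} then insert e ?A else ?A)"
    using e by auto
  have "finite ?A" "e \<notin> ?A" using finite_edges e by auto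
  moreover have "(\<Sum>f\<in>?A. \<phi> v - \<phi> (opposite ?G f v)) = outflow G \<phi> v"
    unfolding outflow_def by (intro sum.cong) (auto simp: opp)
  moreover have "opposite ?G e a = b" "opposite ?G e b = a"
    by (rule opposite_eq, simp add: insert_commute)+
  ultimately show ?thesis
    unfolding outflow_def set using ab by auto
qed

lemma outflow_fresh:
  assumes "finite_multigraph G" "v \<notin> verts G"
  shows "outflow G \<phi> v = 0"
proof -
  interpret finite_multigraph G by fact
  have "{e. e \<in> edges G \<and> v \<in> ends G e} = {}" using assms ends_in_verts by blast
  then show ?thesis unfolding outflow_def by (simp only: sum.empty)
qed

lemma plane_drawing_add_edge:
  assumes G: "finite_multigraph G" and D: "plane_drawing G pos \<gamma>" and e: "e \<notin> edges G" and a: "a \<in> verts G"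
    and ab: "a \<noteq> b" and fresh: "b \<notin> verts G \<Longrightarrow> pos b \<notin> drawing G pos \<gamma>"
    and arc: "arc \<alpha>" "pathstart \<alpha> = pos a" "pathfinish \<alpha> = pos b"
    and im: "path_image \<alpha> \<inter> drawing G pos \<gamma> \<subseteq> {pos a, pos b}"
  shows "plane_drawing (add_edge G e a b) pos (\<gamma>(e := \<alpha>))"
proof -
  interpret finite_multigraph G by fact
  have edge: "ends G f \<subseteq> verts G" "arc (\<gamma> f)" "{pathstart (\<gamma> f), pathfinish (\<gamma> f)} = pos ` ends G f"
    "path_image (\<gamma> f) \<inter> pos ` verts G = pos ` ends G f" if "f \<in> edges G" for f
    using D that ends_in_verts[OF that] unfolding plane_drawing_def by blast+
  have on_vert: "v \<in> ends G f" if "f \<in> edges G" "v \<in> insert b (verts G)" "pos v \<in> path_image (\<gamma> f)" for v f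
  proof -
    have "v \<in> verts G" using that fresh by (auto simp: drawing_def)
    then have "pos v \<in> pos ` ends G f" using edge(4)[OF that(1)] that(3) by blast
    moreover have "inj_on pos (verts G)" using D by (simp add: plane_drawing_def)
    ultimately show ?thesis
      using \<open>v \<in> verts G\<close> edge(1)[OF that(1)] by (auto dest: inj_onD)
  qed
  have in_arc: "pos a \<in> path_image \<alpha>" "pos b \<in> path_image \<alpha>"
    using arc by (metis pathstart_in_path_image, metis pathfinish_in_path_image)
  have new: "path_image \<alpha> \<inter> path_image (\<gamma> f) = pos ` ({a, b} \<inter> ends G f)" if f: "f \<in> edges G" for f
  proof
    show "path_image \<alpha> \<inter> path_image (\<gamma> f) \<subseteq> pos ` ({a, b} \<inter> ends G f)"
    proof
      fix z assume z: "z \<in> path_image \<alpha> \<inter> path_image (\<gamma> f)"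
      then have "z \<in> {pos a, pos b}" using im f by (auto simp: drawing_def)
      then obtain v where v: "v \<in> {a, b}" "z = pos v" by auto
      then have "v \<in> ends G f" using on_vert[OF f, of v] z a by auto
      then show "z \<in> pos ` ({a, b} \<inter> ends G f)" using v by auto
    qed
    show "pos ` ({a, b} \<inter> ends G f) \<subseteq> path_image \<alpha> \<inter> path_image (\<gamma> f)"
      using in_arc edge(4)[OF f] by auto
  qed
  have "inj_on pos (verts G)" using D by (simp add: plane_drawing_def)
  then have inj: "inj_on pos (insert b (verts G))"
    using fresh by (cases "b \<in> verts G") (auto simp: drawing_def insert_absorb)
  show ?thesis
    unfolding plane_drawing_def
  proof (intro conjI ballI impI)
    show "inj_on pos (verts (add_edge G e a b))" using inj a by (simp add: insert_absorb)
    fix f assume f: "f \<in> edges (add_edge G e a b)"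
    show "arc ((\<gamma>(e := \<alpha>)) f)" using f arc edge(2) by auto
    show "{pathstart ((\<gamma>(e := \<alpha>)) f), pathfinish ((\<gamma>(e := \<alpha>)) f)} = pos ` ends (add_edge G e a b) f"
      using f arc edge(3) by auto
    show "path_image ((\<gamma>(e := \<alpha>)) f) \<inter> pos ` verts (add_edge G e a b) = pos ` ends (add_edge G e a b) f"
    proof (cases "f = e")
      case True
      have "path_image \<alpha> \<inter> pos ` verts G \<subseteq> {pos a, pos b}" using im by (auto simp: drawing_def)
      then show ?thesis using True in_arc a by auto
    next
      case False
      then have fE: "f \<in> edges G" using f by simp
      have "pos b \<in> path_image (\<gamma> f) \<longrightarrow> pos b \<in> pos ` ends G f" using on_vert[OF fE, of b] by auto
      then show ?thesis using False edge(4)[OF fE] a by auto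
    qed
    fix g assume g: "g \<in> edges (add_edge G e a b)" "f \<noteq> g"
    show "path_image ((\<gamma>(e := \<alpha>)) f) \<inter> path_image ((\<gamma>(e := \<alpha>)) g) =
        pos ` (ends (add_edge G e a b) f \<inter> ends (add_edge G e a b) g)"
    proof (cases "f = e \<or> g = e")
      case True
      then show ?thesis using f g new by (auto simp: Int_commute)
    next
      case False
      then have "f \<in> edges G" "g \<in> edges G" using f g by auto
      then have "path_image (\<gamma> f) \<inter> path_image (\<gamma> g) = pos ` (ends G f \<inter> ends G g)"
        using D g(2) unfolding plane_drawing_def by blast
      then show ?thesis using False by simp
    qed
  qed
qed

lemma plane_drawing_update:
  assumes "finite_multigraph G" "b \<notin> verts G" "plane_drawing G pos \<gamma>"
  shows "plane_drawing G (pos(b := z)) \<gamma>" and "drawing G (pos(b := z)) \<gamma> = drawing G pos \<gamma>"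
proof -
  interpret finite_multigraph G by fact
  have "(pos(b := z)) ` A = pos ` A" if "A \<subseteq> verts G" for A
    using that assms(2) by (intro image_cong) auto
  moreover have "inj_on (pos(b := z)) (verts G) \<longleftrightarrow> inj_on pos (verts G)"
    using assms(2) by (intro inj_on_cong) auto
  ultimately show "plane_drawing G (pos(b := z)) \<gamma>" "drawing G (pos(b := z)) \<gamma> = drawing G pos \<gamma>"
    using assms(3) ends_in_verts unfolding plane_drawing_def drawing_def
    by (simp_all add: le_infI1)
qed

text \<open>A plane network under construction: all of it lies in the closed left half-plane, and the
  vertices still allowed to exchange current with the outside, the terminals, lie on its boundary. The
  list records potential and net outflow of the terminals from top to bottom. Potentials and currents
  may have any sign.\<close>

definition frontier :: "nat \<Rightarrow> (real \<times> real) list \<Rightarrow> bool" where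
  "frontier n ts \<longleftrightarrow> (\<exists>(G :: (nat, nat) multigraph) \<phi> xs pos \<gamma>.
     finite_multigraph G \<and> connected_graph G \<and> card (edges G) = n \<and>
     plane_drawing G pos \<gamma> \<and> (\<forall>z\<in>drawing G pos \<gamma>. fst z \<le> 0) \<and>
     set xs \<subseteq> verts G \<and> (\<forall>x\<in>set xs. fst (pos x) = 0) \<and>
     sorted_wrt (\<lambda>x y. snd (pos x) > snd (pos y)) xs \<and>
     map (\<lambda>x. (\<phi> x, outflow G \<phi> x)) xs = ts \<and> (\<forall>v\<in>verts G - set xs. outflow G \<phi> v = 0))"

lemma frontier_start: "frontier 0 [(0, 0)]"
proof -
  let ?G = "\<lparr>verts = {0}, edges = {}, ends = \<lambda>_. {}\<rparr> :: (nat, nat) multigraph"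
  have "finite_multigraph ?G" by unfold_locales auto
  then show ?thesis
    unfolding frontier_def
    by (intro exI[of _ ?G] exI[of _ "\<lambda>_. 0"] exI[of _ "[0]"] exI[of _ "\<lambda>_. (0, 0)"] exI[of _ "\<lambda>_ _. (0, 0)"])
      (auto simp: connected_graph_def plane_drawing_def drawing_def outflow_def)
qed

text \<open>A terminal without net outflow satisfies the current law and may become an interior
  vertex.\<close>

lemma frontier_drop:
  assumes "frontier n (us @ (u, 0) # ws)"
  shows "frontier n (us @ ws)"
proof -
  obtain G :: "(nat, nat) multigraph" and \<phi> xs pos \<gamma> where
    G: "finite_multigraph G" "connected_graph G" "card (edges G) = n"
    and D: "plane_drawing G pos \<gamma>" "\<forall>z\<in>drawing G pos \<gamma>. fst z \<le> 0"
    and xs: "set xs \<subseteq> verts G" "\<forall>x\<in>set xs. fst (pos x) = 0" "sorted_wrt (\<lambda>x y. snd (pos x) > snd (pos y)) xs"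
    and \<phi>: "map (\<lambda>x. (\<phi> x, outflow G \<phi> x)) xs = us @ (u, 0) # ws" "\<forall>v\<in>verts G - set xs. outflow G \<phi> v = 0"
    using assms unfolding frontier_def by blast
  from \<phi>(1) obtain ys x zs where "xs = ys @ x # zs" "map (\<lambda>x. (\<phi> x, outflow G \<phi> x)) ys = us"
    "\<phi> x = u" "outflow G \<phi> x = 0" "map (\<lambda>x. (\<phi> x, outflow G \<phi> x)) zs = ws"
    by (auto simp: map_eq_append_conv map_eq_Cons_conv)
  then show ?thesis
    unfolding frontier_def using G D xs \<phi>
    by (intro exI[of _ G] exI[of _ \<phi>] exI[of _ "ys @ zs"] exI[of _ pos] exI[of _ \<gamma>])
      (auto simp: sorted_wrt_append)
qed

text \<open>Potentials are prescribed, not solved for: a new edge leaves them alone and merely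
  changes the outflow at its two ends. The terminals are neighbours on the line, so an arc beside it
  crosses nothing.\<close>

lemma frontier_edge:
  assumes "frontier n (us @ (u, i) # (v, j) # ws)"
  shows "frontier (Suc n) (us @ (u, i + (u - v)) # (v, j - (u - v)) # ws)"
proof -
  obtain G :: "(nat, nat) multigraph" and \<phi> xs pos \<gamma> where
    G: "finite_multigraph G" "connected_graph G" "card (edges G) = n"
    and D: "plane_drawing G pos \<gamma>" "\<forall>z\<in>drawing G pos \<gamma>. fst z \<le> 0"
    and xs: "set xs \<subseteq> verts G" "\<forall>x\<in>set xs. fst (pos x) = 0" "sorted_wrt (\<lambda>x y. snd (pos x) > snd (pos y)) xs"
    and \<phi>: "map (\<lambda>x. (\<phi> x, outflow G \<phi> x)) xs = us @ (u, i) # (v, j) # ws"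
      "\<forall>v\<in>verts G - set xs. outflow G \<phi> v = 0"
    using assms unfolding frontier_def by blast
  interpret finite_multigraph G by fact
  from \<phi>(1) obtain ys x y zs where eq: "xs = ys @ x # y # zs"
    and vals: "map (\<lambda>x. (\<phi> x, outflow G \<phi> x)) ys = us" "\<phi> x = u" "outflow G \<phi> x = i"
      "\<phi> y = v" "outflow G \<phi> y = j" "map (\<lambda>x. (\<phi> x, outflow G \<phi> x)) zs = ws"
    by (auto simp: map_eq_append_conv map_eq_Cons_conv)
  define H where "H = (snd \<circ> pos) ` set xs"
  have H: "finite H" by (simp add: H_def)
  obtain pos' \<gamma>' where D': "plane_drawing G pos' \<gamma>'"
    and pos': "\<And>v. pos' v = (fst (pos v) - infdist (snd (pos v)) H, snd (pos v))"
    and le: "\<And>z. z \<in> drawing G pos' \<gamma>' \<Longrightarrow> fst z \<le> - infdist (snd z) H"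
    using shear_drawing[OF D(1)] D(2) by metis
  have posT: "pos' t = (0, snd (pos t))" if "t \<in> set xs" for t
    using that xs(2) by (simp add: pos' H_def)
  have xyH: "x \<in> set xs" "y \<in> set xs" "snd (pos x) \<in> H" "snd (pos y) \<in> H" "snd (pos x) \<noteq> snd (pos y)"
    using xs(3) by (auto simp: eq H_def sorted_wrt_append)
  have gap: "H \<inter> closed_segment (snd (pos x)) (snd (pos y)) = {snd (pos x), snd (pos y)}"
    using xs(3) unfolding H_def eq by (auto simp: sorted_wrt_append closed_segment_eq_real_ivl)
  obtain \<alpha> where "arc \<alpha>" "pathstart \<alpha> = (0, snd (pos x))" "pathfinish \<alpha> = (0, snd (pos y))"
    "path_image \<alpha> \<inter> drawing G pos' \<gamma>' \<subseteq> {(0, snd (pos x)), (0, snd (pos y))}"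
    and \<alpha>le: "\<And>z. z \<in> path_image \<alpha> \<Longrightarrow> fst z \<le> 0"
    using arc_in_gap[OF H xyH(3) order_refl H xyH(4,5) gap le] by blast
  then have \<alpha>: "arc \<alpha>" "pathstart \<alpha> = pos' x" "pathfinish \<alpha> = pos' y"
    "path_image \<alpha> \<inter> drawing G pos' \<gamma>' \<subseteq> {pos' x, pos' y}"
    using posT xyH(1,2) by simp_all
  obtain e where e: "e \<notin> edges G" using ex_new_if_finite[OF infinite_UNIV_nat finite_edges] by blast
  let ?G = "add_edge G e x y"
  have xy: "x \<noteq> y" "x \<in> verts G" "y \<in> verts G" "x \<notin> set ys" "x \<notin> set zs" "y \<notin> set ys" "y \<notin> set zs"
    using xs unfolding eq by (auto simp: sorted_wrt_append)
  note out = outflow_add_edge[OF G(1) e xy(1)]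
  have "plane_drawing ?G pos' (\<gamma>'(e := \<alpha>))"
    using plane_drawing_add_edge[OF G(1) D' e xy(2) xy(1) _ \<alpha>] xy by simp
  moreover have "fst z \<le> 0" if "z \<in> drawing ?G pos' (\<gamma>'(e := \<alpha>))" for z
  proof -
    have "z \<in> drawing G pos' \<gamma>' \<or> z \<in> path_image \<alpha>"
      using that xy by (auto simp: drawing_def split: if_splits)
    then show ?thesis using le[of z] \<alpha>le[of z] infdist_nonneg[of "snd z" H] by auto
  qed
  moreover have "map (\<lambda>x. (\<phi> x, outflow ?G \<phi> x)) xs = us @ (u, i + (u - v)) # (v, j - (u - v)) # ws"
  proof -
    have "map (\<lambda>x. (\<phi> x, outflow ?G \<phi> x)) ys = us" "map (\<lambda>x. (\<phi> x, outflow ?G \<phi> x)) zs = ws"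
      using xy vals(1,6) by (auto simp: out)
    then show ?thesis using vals xy by (simp add: eq out)
  qed
  moreover have "outflow ?G \<phi> t = 0" if "t \<in> verts ?G - set xs" for t
    using that \<phi>(2) xy by (auto simp: out eq)
  moreover have "sorted_wrt (\<lambda>x y. snd (pos' x) > snd (pos' y)) xs"
    using xs(3) by (simp add: pos')
  ultimately show ?thesis
    unfolding frontier_def using finite_multigraph_add_edge[OF G(1) e xy(1)]
      connected_graph_add_edge[OF G(2) e xy(2), of y] e G(3) finite_edges xs(1) posT
    by (intro exI[of _ ?G] exI[of _ \<phi>] exI[of _ xs] exI[of _ pos'] exI[of _ "\<gamma>'(e := \<alpha>)"]) auto
qed

lemma ex_between_finite:
  fixes c :: real
  assumes "finite M" "\<forall>m\<in>M. c < m"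
  shows "\<exists>y>c. \<forall>m\<in>M. y < m"
  using assms
proof (induction M rule: finite_induct)
  case empty
  show ?case by (auto intro: gt_ex)
next
  case (insert m M)
  then obtain y where "y > c" "\<forall>m\<in>M. y < m" by auto
  then show ?case using insert.prems by (intro exI[of _ "min y ((c + m) / 2)"]) (auto simp: min_def)
qed

lemma frontier_grow:
  assumes "frontier n (us @ (u, i) # ws)"
  shows "frontier (Suc n) (us @ (w, w - u) # (u, i - (w - u)) # ws)"
proof -
  obtain G :: "(nat, nat) multigraph" and \<phi> xs pos \<gamma> where
    G: "finite_multigraph G" "connected_graph G" "card (edges G) = n"
    and D: "plane_drawing G pos \<gamma>" "\<forall>z\<in>drawing G pos \<gamma>. fst z \<le> 0"
    and xs: "set xs \<subseteq> verts G" "\<forall>x\<in>set xs. fst (pos x) = 0" "sorted_wrt (\<lambda>x y. snd (pos x) > snd (pos y)) xs"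
    and \<phi>: "map (\<lambda>x. (\<phi> x, outflow G \<phi> x)) xs = us @ (u, i) # ws"
      "\<forall>v\<in>verts G - set xs. outflow G \<phi> v = 0"
    using assms unfolding frontier_def by blast
  interpret finite_multigraph G by fact
  from \<phi>(1) obtain ys x zs where eq: "xs = ys @ x # zs"
    and vals: "map (\<lambda>x. (\<phi> x, outflow G \<phi> x)) ys = us" "\<phi> x = u" "outflow G \<phi> x = i"
      "map (\<lambda>x. (\<phi> x, outflow G \<phi> x)) zs = ws"
    by (auto simp: map_eq_append_conv map_eq_Cons_conv)
  have x: "x \<in> verts G" "x \<in> set xs" using xs(1) eq by auto
  obtain b where b: "b \<notin> verts G" using ex_new_if_finite[OF infinite_UNIV_nat finite_verts] by blast
  obtain e where e: "e \<notin> edges G" using ex_new_if_finite[OF infinite_UNIV_nat finite_edges] by blast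
  \<comment> \<open>The new terminal goes above x but below all terminals listed before x, so the
    list remains sorted by height and the new edge spans an empty gap.\<close>
  obtain c where c: "c > snd (pos x)" "\<forall>m\<in>(snd \<circ> pos) ` set ys. c < m"
    using ex_between_finite[of "(snd \<circ> pos) ` set ys" "snd (pos x)"] xs(3)
    by (auto simp: eq sorted_wrt_append)
  define H where "H = (snd \<circ> pos) ` set xs"
  have H: "finite H" by (simp add: H_def)
  obtain pos\<^sub>1 \<gamma>' where D\<^sub>1: "plane_drawing G pos\<^sub>1 \<gamma>'"
    and pos\<^sub>1: "\<And>v. pos\<^sub>1 v = (fst (pos v) - infdist (snd (pos v)) H, snd (pos v))"
    and le\<^sub>1: "\<And>z. z \<in> drawing G pos\<^sub>1 \<gamma>' \<Longrightarrow> fst z \<le> - infdist (snd z) H"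
    using shear_drawing[OF D(1)] D(2) by metis
  define pos' where "pos' = pos\<^sub>1(b := (0, c))"
  have D': "plane_drawing G pos' \<gamma>'" and dr: "drawing G pos' \<gamma>' = drawing G pos\<^sub>1 \<gamma>'"
    using plane_drawing_update[OF G(1) b D\<^sub>1, of "(0, c)"] by (simp_all add: pos'_def)
  note le = le\<^sub>1[folded dr]
  have nb: "t \<noteq> b" if "t \<in> set xs" for t using that xs(1) b by auto
  have posT: "pos' t = (0, snd (pos t))" if "t \<in> set xs" for t
    using that xs(2) nb[OF that] by (simp add: pos'_def pos\<^sub>1 H_def)
  have cH: "c \<notin> H" and gap: "insert c H \<inter> closed_segment (snd (pos x)) c = {snd (pos x), c}"
    using xs(3) c unfolding H_def eq by (auto simp: sorted_wrt_append closed_segment_eq_real_ivl)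
  have posb: "pos' b = (0, c)" by (simp add: pos'_def)
  have fresh: "pos' b \<notin> drawing G pos' \<gamma>'"
  proof
    assume "pos' b \<in> drawing G pos' \<gamma>'"
    then have "infdist c H \<le> 0" using le[of "pos' b"] by (simp add: posb)
    then have "infdist c H = 0" using infdist_nonneg[of c H] by simp
    moreover have "H \<noteq> {}" using x(2) by (auto simp: H_def)
    ultimately show False
      using in_closed_iff_infdist_zero[OF finite_imp_closed[OF H], of c] cH by simp
  qed
  have xH: "snd (pos x) \<in> H" "c \<in> insert c H" "snd (pos x) \<noteq> c" "finite (insert c H)"
    using x(2) c(1) H by (auto simp: H_def)
  obtain \<alpha> where "arc \<alpha>" "pathstart \<alpha> = (0, snd (pos x))" "pathfinish \<alpha> = (0, c)"
    "path_image \<alpha> \<inter> drawing G pos' \<gamma>' \<subseteq> {(0, snd (pos x)), (0, c)}"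
    and \<alpha>le: "\<And>z. z \<in> path_image \<alpha> \<Longrightarrow> fst z \<le> 0"
    using arc_in_gap[OF H xH(1) subset_insertI xH(4,2,3) gap le] by blast
  then have \<alpha>: "arc \<alpha>" "pathstart \<alpha> = pos' x" "pathfinish \<alpha> = pos' b"
    "path_image \<alpha> \<inter> drawing G pos' \<gamma>' \<subseteq> {pos' x, pos' b}"
    using posT[OF x(2)] posb by simp_all
  let ?G = "add_edge G e x b" and ?\<phi> = "\<phi>(b := w)" and ?xs = "ys @ b # x # zs"
  have xb: "x \<noteq> b" using b x by auto
  have nxs: "x \<notin> set ys" "x \<notin> set zs" using xs(3) by (auto simp: eq sorted_wrt_append)
  have out: "outflow ?G ?\<phi> t = outflow G \<phi> t + (if t = x then \<phi> x - w else if t = b then w - \<phi> x else 0)"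
    if "t \<in> verts G \<or> t = b" for t
  proof -
    have "outflow G ?\<phi> t = outflow G \<phi> t"
      using that b outflow_fresh[OF G(1) b] by (cases "t = b") (auto intro!: outflow_cong)
    then show ?thesis using outflow_add_edge[OF G(1) e xb, of ?\<phi> t] xb by simp
  qed
  have "plane_drawing ?G pos' (\<gamma>'(e := \<alpha>))"
    using plane_drawing_add_edge[OF G(1) D' e x(1) xb fresh \<alpha>] .
  moreover have "fst z \<le> 0" if "z \<in> drawing ?G pos' (\<gamma>'(e := \<alpha>))" for z
  proof -
    have "z \<in> drawing G pos' \<gamma>' \<or> z \<in> path_image \<alpha> \<or> z = (0, c)"
      using that x posb by (auto simp: drawing_def split: if_splits)
    then show ?thesis using le[of z] \<alpha>le[of z] infdist_nonneg[of "snd z" H] by auto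
  qed
  moreover have "map (\<lambda>x. (?\<phi> x, outflow ?G ?\<phi> x)) ?xs = us @ (w, w - u) # (u, i - (w - u)) # ws"
  proof -
    have same: "(?\<phi> t, outflow ?G ?\<phi> t) = (\<phi> t, outflow G \<phi> t)" if "t \<in> set ys \<union> set zs" for t
      using that xs(1) nxs b out[of t] by (auto simp: eq)
    have "map (\<lambda>x. (?\<phi> x, outflow ?G ?\<phi> x)) ys = us" "map (\<lambda>x. (?\<phi> x, outflow ?G ?\<phi> x)) zs = ws"
      unfolding vals(1,4)[symmetric] by (intro map_cong refl same; simp)+
    then show ?thesis using out[of x] out[of b] outflow_fresh[OF G(1) b] x(1) xb vals by simp
  qed
  moreover have "outflow ?G ?\<phi> t = 0" if "t \<in> verts ?G - set ?xs" for t
    using that \<phi>(2) x out[of t] by (auto simp: eq)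
  moreover have "sorted_wrt (\<lambda>x y. snd (pos' x) > snd (pos' y)) ?xs"
  proof -
    have "snd (pos' t) = snd (pos t)" if "t \<in> set xs" for t using posT[OF that] by simp
    then have "sorted_wrt (\<lambda>x y. snd (pos' x) > snd (pos' y)) xs"
      using xs(3) by (metis (no_types, lifting) sorted_wrt_mono_rel)
    then show ?thesis
      using c x posT by (fastforce simp: eq sorted_wrt_append posb)
  qed
  moreover have "\<forall>t\<in>set ?xs. fst (pos' t) = 0" using posT posb by (auto simp: eq)
  ultimately show ?thesis
    unfolding frontier_def using finite_multigraph_add_edge[OF G(1) e xb]
      connected_graph_add_edge[OF G(2) e x(1), of b] e G(3) finite_edges xs(1)
    by (intro exI[of _ ?G] exI[of _ ?\<phi>] exI[of _ ?xs] exI[of _ pos'] exI[of _ "\<gamma>'(e := \<alpha>)"]) (auto simp: eq)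
qed

text \<open>Potentials in a frontier are not normalised; division by h yields the potential of the
  definition, with total current r / h.\<close>

lemma frontier_resistance:
  fixes h r :: real
  assumes "frontier n [(h, r), (0, -r)]" "h > 0" "r > 0"
  shows "\<exists>(G :: (nat, nat) multigraph) a b. finite_multigraph G \<and> connected_graph G \<and> planar G \<and>
    a \<in> verts G \<and> b \<in> verts G \<and> a \<noteq> b \<and> effective_resistance G a b = h / r \<and> card (edges G) = n"
proof -
  obtain G :: "(nat, nat) multigraph" and \<phi> xs pos \<gamma> where
    G: "finite_multigraph G" "connected_graph G" "card (edges G) = n"
    and D: "plane_drawing G pos \<gamma>" "\<forall>z\<in>drawing G pos \<gamma>. fst z \<le> 0"
    and xs: "set xs \<subseteq> verts G" "\<forall>x\<in>set xs. fst (pos x) = 0" "sorted_wrt (\<lambda>x y. snd (pos x) > snd (pos y)) xs"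
    and \<phi>: "map (\<lambda>x. (\<phi> x, outflow G \<phi> x)) xs = [(h, r), (0, -r)]" "\<forall>v\<in>verts G - set xs. outflow G \<phi> v = 0"
    using assms(1) unfolding frontier_def by (elim exE conjE) (rule that)
  interpret finite_multigraph G by fact
  from \<phi>(1) obtain a b where ab: "xs = [a, b]" "\<phi> a = h" "\<phi> b = 0" "outflow G \<phi> a = r"
    by (auto simp: map_eq_Cons_conv)
  then have V: "a \<in> verts G" "b \<in> verts G" "a \<noteq> b" using xs by auto
  have "is_potential G a b (\<lambda>v. \<phi> v / h)"
    using ab \<phi>(2) assms(2) by (auto simp: is_potential_def outflow_divide)
  then have "effective_resistance G a b = h / r"
    using effective_resistance_eq[OF G(2) V(1,2)] ab by (simp add: outflow_divide)
  then show ?thesis using G V D(1) by (auto simp: planar_def)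
qed

section \<open>Series and parallel connections\<close>

text \<open>A demand rather than a graph: in any surrounding network, n edges can be placed on a
  terminal so that a new terminal, higher in potential by h, feeds current r into them. Quantifying
  over the surroundings makes parts composable and leaves planarity to
  \<open>frontier\<close>.\<close>

definition resistor :: "nat \<Rightarrow> real \<Rightarrow> real \<Rightarrow> bool" where
  "resistor n h r \<longleftrightarrow> (\<forall>N us u j ws. frontier N (us @ (u, j) # ws) \<longrightarrow>
     frontier (N + n) (us @ (u + h, r) # (u, j - r) # ws))"

text \<open>A part with three terminals. It need not decompose into two resistors at the middle
  terminal, which leaves room for the bridge.\<close>

definition resistor_pair :: "nat \<Rightarrow> real \<Rightarrow> real \<Rightarrow> real \<Rightarrow> real \<Rightarrow> bool" where
  "resistor_pair n h\<^sub>1 r\<^sub>1 h\<^sub>2 r\<^sub>2 \<longleftrightarrow> (\<forall>N us u j ws. frontier N (us @ (u, j) # ws) \<longrightarrow>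
     frontier (N + n) (us @ (u + h\<^sub>2 + h\<^sub>1, r\<^sub>1) # (u + h\<^sub>2, r\<^sub>2 - r\<^sub>1) # (u, j - r\<^sub>2) # ws))"

lemma resistorD:
  "resistor n h r \<Longrightarrow> frontier N (us @ (u, j) # ws) \<Longrightarrow> frontier (N + n) (us @ (u + h, r) # (u, j - r) # ws)"
  by (simp add: resistor_def)

lemma resistor_pairD:
  "resistor_pair n h\<^sub>1 r\<^sub>1 h\<^sub>2 r\<^sub>2 \<Longrightarrow> frontier N (us @ (u, j) # ws) \<Longrightarrow>
    frontier (N + n) (us @ (u + h\<^sub>2 + h\<^sub>1, r\<^sub>1) # (u + h\<^sub>2, r\<^sub>2 - r\<^sub>1) # (u, j - r\<^sub>2) # ws)"
  by (simp add: resistor_pair_def)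

lemma resistor_unit: "resistor 1 h h"
  unfolding resistor_def
proof (intro allI impI)
  fix N us u j ws assume "frontier N (us @ (u, j) # ws)"
  from frontier_grow[OF this, of "u + h"]
  show "frontier (N + 1) (us @ (u + h, h) # (u, j - h) # ws)" by simp
qed

lemma resistor_series:
  assumes "resistor n h r"
  shows "resistor (Suc n) (h + r) r"
  unfolding resistor_def
proof (intro allI impI)
  fix N us u j ws assume "frontier N (us @ (u, j) # ws)"
  from frontier_grow[OF resistorD[OF assms this], of "u + h + r"]
  have "frontier (N + Suc n) ((us @ [(u + h + r, r)]) @ (u + h, 0) # (u, j - r) # ws)" by simp
  from frontier_drop[OF this]
  show "frontier (N + Suc n) (us @ (u + (h + r), r) # (u, j - r) # ws)" by (simp add: add.assoc)
qed

lemma resistor_parallel: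
  assumes "resistor n h r"
  shows "resistor (Suc n) h (h + r)"
  unfolding resistor_def
proof (intro allI impI)
  fix N us u j ws assume "frontier N (us @ (u, j) # ws)"
  from frontier_edge[OF resistorD[OF assms this]]
  show "frontier (N + Suc n) (us @ (u + h, h + r) # (u, j - (h + r)) # ws)" by (simp add: algebra_simps)
qed

lemma resistor_pairI:
  assumes "resistor m h\<^sub>1 r\<^sub>1" "resistor n h\<^sub>2 r\<^sub>2"
  shows "resistor_pair (m + n) h\<^sub>1 r\<^sub>1 h\<^sub>2 r\<^sub>2"
  unfolding resistor_pair_def
proof (intro allI impI)
  fix N us u j ws assume "frontier N (us @ (u, j) # ws)"
  from resistorD[OF assms(1) resistorD[OF assms(2) this]]
  show "frontier (N + (m + n)) (us @ (u + h\<^sub>2 + h\<^sub>1, r\<^sub>1) # (u + h\<^sub>2, r\<^sub>2 - r\<^sub>1) # (u, j - r\<^sub>2) # ws)"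
    by (simp add: add_ac)
qed

text \<open>With equal currents the middle terminal has no net outflow. Read backwards, this splits
  a voltage at an arbitrary point.\<close>

lemma resistor_merge:
  assumes "resistor_pair n h\<^sub>1 r h\<^sub>2 r"
  shows "resistor n (h\<^sub>1 + h\<^sub>2) r"
  unfolding resistor_def
proof (intro allI impI)
  fix N us u j ws assume "frontier N (us @ (u, j) # ws)"
  from resistor_pairD[OF assms this]
  have "frontier (N + n) ((us @ [(u + h\<^sub>2 + h\<^sub>1, r)]) @ (u + h\<^sub>2, 0) # (u, j - r) # ws)" by simp
  from frontier_drop[OF this]
  show "frontier (N + n) (us @ (u + (h\<^sub>1 + h\<^sub>2), r) # (u, j - r) # ws)" by (simp add: add_ac)
qed

lemma resistor_pair_series_1:
  assumes "resistor_pair n h\<^sub>1 r\<^sub>1 h\<^sub>2 r\<^sub>2"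
  shows "resistor_pair (Suc n) (h\<^sub>1 + r\<^sub>1) r\<^sub>1 h\<^sub>2 r\<^sub>2"
  unfolding resistor_pair_def
proof (intro allI impI)
  fix N us u j ws assume "frontier N (us @ (u, j) # ws)"
  from frontier_grow[OF resistor_pairD[OF assms this], of "u + h\<^sub>2 + h\<^sub>1 + r\<^sub>1"]
  have "frontier (N + Suc n) ((us @ [(u + h\<^sub>2 + h\<^sub>1 + r\<^sub>1, r\<^sub>1)]) @ (u + h\<^sub>2 + h\<^sub>1, 0) #
      (u + h\<^sub>2, r\<^sub>2 - r\<^sub>1) # (u, j - r\<^sub>2) # ws)" by simp
  from frontier_drop[OF this]
  show "frontier (N + Suc n) (us @ (u + h\<^sub>2 + (h\<^sub>1 + r\<^sub>1), r\<^sub>1) # (u + h\<^sub>2, r\<^sub>2 - r\<^sub>1) # (u, j - r\<^sub>2) # ws)"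
    by (simp add: add.assoc)
qed

lemma resistor_pair_parallel_1:
  assumes "resistor_pair n h\<^sub>1 r\<^sub>1 h\<^sub>2 r\<^sub>2"
  shows "resistor_pair (Suc n) h\<^sub>1 (h\<^sub>1 + r\<^sub>1) h\<^sub>2 r\<^sub>2"
  unfolding resistor_pair_def
proof (intro allI impI)
  fix N us u j ws assume "frontier N (us @ (u, j) # ws)"
  from frontier_edge[OF resistor_pairD[OF assms this]]
  show "frontier (N + Suc n) (us @ (u + h\<^sub>2 + h\<^sub>1, h\<^sub>1 + r\<^sub>1) # (u + h\<^sub>2, r\<^sub>2 - (h\<^sub>1 + r\<^sub>1)) # (u, j - r\<^sub>2) # ws)"
    by (simp add: algebra_simps)
qed

lemma resistor_pair_series_2:
  assumes "resistor_pair n h\<^sub>1 r\<^sub>1 h\<^sub>2 r\<^sub>2"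
  shows "resistor_pair (Suc n) h\<^sub>1 r\<^sub>1 (h\<^sub>2 + r\<^sub>2) r\<^sub>2"
  unfolding resistor_pair_def
proof (intro allI impI)
  fix N us u j ws assume "frontier N (us @ (u, j) # ws)"
  \<comment> \<open>Networks grow upwards only, so a series edge of the lower part is placed beneath
    it, before the pair is attached.\<close>
  from frontier_grow[OF this, of "u + r\<^sub>2"]
  have "frontier (Suc N) (us @ (u + r\<^sub>2, r\<^sub>2) # (u, j - r\<^sub>2) # ws)" by simp
  from resistor_pairD[OF assms this]
  have "frontier (N + Suc n) ((us @ [(u + r\<^sub>2 + h\<^sub>2 + h\<^sub>1, r\<^sub>1), (u + r\<^sub>2 + h\<^sub>2, r\<^sub>2 - r\<^sub>1)]) @
      (u + r\<^sub>2, 0) # (u, j - r\<^sub>2) # ws)" by simp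
  from frontier_drop[OF this]
  show "frontier (N + Suc n) (us @ (u + (h\<^sub>2 + r\<^sub>2) + h\<^sub>1, r\<^sub>1) # (u + (h\<^sub>2 + r\<^sub>2), r\<^sub>2 - r\<^sub>1) # (u, j - r\<^sub>2) # ws)"
    by (simp add: algebra_simps)
qed

lemma resistor_pair_parallel_2:
  assumes "resistor_pair n h\<^sub>1 r\<^sub>1 h\<^sub>2 r\<^sub>2"
  shows "resistor_pair (Suc n) h\<^sub>1 r\<^sub>1 h\<^sub>2 (h\<^sub>2 + r\<^sub>2)"
  unfolding resistor_pair_def
proof (intro allI impI)
  fix N us u j ws assume "frontier N (us @ (u, j) # ws)"
  from resistor_pairD[OF assms this]
  have "frontier (N + n) ((us @ [(u + h\<^sub>2 + h\<^sub>1, r\<^sub>1)]) @ (u + h\<^sub>2, r\<^sub>2 - r\<^sub>1) # (u, j - r\<^sub>2) # ws)" by simp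
  from frontier_edge[OF this]
  show "frontier (N + Suc n) (us @ (u + h\<^sub>2 + h\<^sub>1, r\<^sub>1) # (u + h\<^sub>2, h\<^sub>2 + r\<^sub>2 - r\<^sub>1) # (u, j - (h\<^sub>2 + r\<^sub>2)) # ws)"
    by (simp add: algebra_simps)
qed

text \<open>The middle terminal of the new pair is a fresh vertex joined by unit edges to the two inner
  terminals of a chain of three resistors; the parameter \<open>s\<close> is the current on the first of these
  edges, and the current law at both inner terminals dictates the three resistors.\<close>

lemma resistor_pair_bridge:
  assumes pair: "resistor_pair m (h\<^sub>1 - s) r\<^sub>1 (2 * s - r\<^sub>1 + r\<^sub>2) (r\<^sub>1 - s)"
    and single: "resistor n (h\<^sub>2 + r\<^sub>1 - r\<^sub>2 - s) r\<^sub>2"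
  shows "resistor_pair (m + n + 2) h\<^sub>1 r\<^sub>1 h\<^sub>2 r\<^sub>2"
  unfolding resistor_pair_def
proof (intro allI impI)
  fix N us u j ws assume F: "frontier N (us @ (u, j) # ws)"
  \<comment> \<open>\<open>?v\<close> is the potential of the lower inner terminal; the upper one is
    at \<open>u + h\<^sub>2 + s\<close>. The unit edges from the middle terminal at
    \<open>u + h\<^sub>2\<close> thus have voltages \<open>s - r\<^sub>1 + r\<^sub>2\<close>
    downwards and \<open>- s\<close> upwards, which add up to its required outflow.\<close>
  let ?v = "u + (h\<^sub>2 + r\<^sub>1 - r\<^sub>2 - s)"
  have "frontier (N + n + m) ((us @ [(u + h\<^sub>2 + h\<^sub>1, r\<^sub>1), (u + h\<^sub>2 + s, - s)]) @ (?v, r\<^sub>2 - (r\<^sub>1 - s)) # (u, j - r\<^sub>2) # ws)"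
    using resistor_pairD[OF pair resistorD[OF single F]] by (simp add: algebra_simps)
  from frontier_grow[OF this, of "u + h\<^sub>2"]
  have "frontier (Suc (N + n + m)) ((us @ [(u + h\<^sub>2 + h\<^sub>1, r\<^sub>1), (u + h\<^sub>2 + s, - s), (u + h\<^sub>2, s - r\<^sub>1 + r\<^sub>2)]) @
      (?v, 0) # (u, j - r\<^sub>2) # ws)"
    by (simp add: algebra_simps)
  from frontier_drop[OF this]
  have "frontier (Suc (N + n + m)) ((us @ [(u + h\<^sub>2 + h\<^sub>1, r\<^sub>1)]) @ (u + h\<^sub>2 + s, - s) # (u + h\<^sub>2, s - r\<^sub>1 + r\<^sub>2) #
      (u, j - r\<^sub>2) # ws)" by simp
  from frontier_edge[OF this]
  have "frontier (Suc (Suc (N + n + m))) ((us @ [(u + h\<^sub>2 + h\<^sub>1, r\<^sub>1)]) @ (u + h\<^sub>2 + s, 0) # (u + h\<^sub>2, r\<^sub>2 - r\<^sub>1) #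
      (u, j - r\<^sub>2) # ws)" by simp
  from frontier_drop[OF this]
  show "frontier (N + (m + n + 2)) (us @ (u + h\<^sub>2 + h\<^sub>1, r\<^sub>1) # (u + h\<^sub>2, r\<^sub>2 - r\<^sub>1) # (u, j - r\<^sub>2) # ws)"
    by (simp add: add_ac)
qed

section \<open>Steps of the subtractive Euclidean algorithm, read from the small pair
  upwards\<close>

inductive euclid :: "real \<Rightarrow> real \<Rightarrow> nat \<Rightarrow> real \<Rightarrow> real \<Rightarrow> bool" for x' y' where
  refl: "euclid x' y' 0 x' y'"
| series: "euclid x' y' k x y \<Longrightarrow> euclid x' y' (Suc k) (x + y) y"
| parallel: "euclid x' y' k x y \<Longrightarrow> euclid x' y' (Suc k) x (x + y)"

lemma resistor_euclid: "euclid x' y' k x y \<Longrightarrow> resistor n x' y' \<Longrightarrow> resistor (n + k) x y"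
  by (induction rule: euclid.induct) (auto intro: resistor_series resistor_parallel)

lemma resistor_pair_euclid_1:
  "euclid x' y' k x y \<Longrightarrow> resistor_pair n x' y' h\<^sub>2 r\<^sub>2 \<Longrightarrow> resistor_pair (n + k) x y h\<^sub>2 r\<^sub>2"
  by (induction rule: euclid.induct) (auto intro: resistor_pair_series_1 resistor_pair_parallel_1)

lemma resistor_pair_euclid_2:
  "euclid x' y' k x y \<Longrightarrow> resistor_pair n h\<^sub>1 r\<^sub>1 x' y' \<Longrightarrow> resistor_pair (n + k) h\<^sub>1 r\<^sub>1 x y"
  by (induction rule: euclid.induct) (auto intro: resistor_pair_series_2 resistor_pair_parallel_2)

lemma Ints_pos_ge_1: "x \<in> \<int> \<Longrightarrow> 0 < x \<Longrightarrow> 1 \<le> (x :: real)"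
  by (elim Ints_cases) auto

text \<open>Plain subtractive Euclidean algorithm: each edge lowers h + r by at least 1. It serves
  demands of bounded size only.\<close>

lemma resistor_exists:
  fixes h r :: real
  assumes "h \<in> \<int>" "r \<in> \<int>" "0 < h" "0 < r"
  shows "\<exists>n. real n \<le> h + r \<and> resistor n h r"
proof -
  have "\<exists>n. real n \<le> h + r \<and> resistor n h r"
    if "h \<in> \<int>" "r \<in> \<int>" "0 < h" "0 < r" "h + r \<le> real k" for k h r
    using that
  proof (induction k arbitrary: h r)
    case 0
    then show ?case by simp
  next
    case (Suc k)
    have ge: "1 \<le> h" "1 \<le> r" using Suc.prems Ints_pos_ge_1 by auto
    consider "h = r" | "h > r" | "h < r" by linarith
    then show ?case
    proof cases
      case 1
      then show ?thesis using ge resistor_unit by (intro exI[of _ 1]) auto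
    next
      case 2
      then obtain n where "real n \<le> h - r + r" "resistor n (h - r) r"
        using Suc.IH[of "h - r" r] Suc.prems ge by auto
      then show ?thesis using ge resistor_series[of n "h - r" r] by (intro exI[of _ "Suc n"]) auto
    next
      case 3
      then obtain n where "real n \<le> h + (r - h)" "resistor n h (r - h)"
        using Suc.IH[of h "r - h"] Suc.prems ge by auto
      then show ?thesis using ge resistor_parallel[of n h "r - h"] by (intro exI[of _ "Suc n"]) auto
    qed
  qed
  then show ?thesis using assms real_arch_simple[of "h + r"] by blast
qed

section \<open>Badly approximable integers\<close>

text \<open>At most one point of D lies within m of the midpoint of the interval of length m at a.
  Of its first and last quarter, the one on the far side of that point is taken.\<close>

lemma avoid_sparse_points:
  fixes D :: "real set"
  assumes m: "0 < m" and D: "\<And>x y. x \<in> D \<Longrightarrow> y \<in> D \<Longrightarrow> x \<noteq> y \<Longrightarrow> 2 * m < \<bar>x - y\<bar>"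
  shows "\<exists>a'\<ge>a. a' + m / 4 \<le> a + m \<and> (\<forall>x\<in>D. \<forall>s\<in>{a'..a' + m / 4}. m / 4 \<le> \<bar>s - x\<bar>)"
proof (cases "\<exists>x\<in>D. \<bar>x - (a + m / 2)\<bar> \<le> m")
  case True
  then obtain x where x: "x \<in> D" "\<bar>x - (a + m / 2)\<bar> \<le> m" by blast
  define a' where "a' = (if x \<le> a + m / 2 then a + 3 * m / 4 else a)"
  have "m / 4 \<le> \<bar>s - y\<bar>" if y: "y \<in> D" and s: "s \<in> {a'..a' + m / 4}" for y s
  proof (cases "y = x")
    case True
    then show ?thesis using s x(2) m by (auto simp: a'_def abs_le_iff split: if_splits)
  next
    case False
    then have "2 * m < \<bar>y - x\<bar>" using D y x by blast
    moreover have "\<bar>s - (a + m / 2)\<bar> \<le> m / 2" using s m by (auto simp: a'_def abs_le_iff split: if_splits)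
    ultimately show ?thesis using x(2) m by linarith
  qed
  moreover have "a \<le> a'" "a' + m / 4 \<le> a + m" using m by (auto simp: a'_def)
  ultimately show ?thesis by blast
next
  case False
  have "m / 4 \<le> \<bar>s - x\<bar>" if "x \<in> D" "s \<in> {a..a + m / 4}" for x s
  proof -
    have "m < \<bar>x - (a + m / 2)\<bar>" "\<bar>s - (a + m / 2)\<bar> \<le> m / 2" using that False m by (auto simp: abs_le_iff)
    then show ?thesis using m by linarith
  qed
  then show ?thesis using m by (intro exI[of _ a]) auto
qed

text \<open>Distinct fractions with denominators Q and Q' differ by at least 1 / (Q Q'), and the two
  denominator bounds multiply to 2 m Q Q' < R.\<close>

lemma fractions_sparse:
  fixes Q Q' P P' :: int and R m :: real
  assumes "R > 0" "m > 0" "Q \<ge> 1" "Q' \<ge> 1" "2 * (real_of_int Q)\<^sup>2 * m < R" "2 * (real_of_int Q')\<^sup>2 * m < R"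
    and ne: "b + P * R / Q \<noteq> b + P' * R / Q'"
  shows "2 * m < \<bar>(b + P * R / Q) - (b + P' * R / Q')\<bar>"
proof -
  have Q: "real_of_int Q > 0" "real_of_int Q' > 0" using assms by auto
  have eq: "(b + P * R / Q) - (b + P' * R / Q') = (P * Q' - P' * Q) * R / (Q * Q')"
    using Q by (simp add: field_simps)
  have "P * Q' - P' * Q \<noteq> 0" using ne Q by (auto simp: field_simps simp flip: of_int_mult)
  then have "1 \<le> \<bar>P * Q' - P' * Q\<bar>" by linarith
  then have one: "1 \<le> \<bar>real_of_int (P * Q' - P' * Q)\<bar>" by linarith
  have "(2 * m * (Q * Q'))\<^sup>2 = (2 * (real_of_int Q)\<^sup>2 * m) * (2 * (real_of_int Q')\<^sup>2 * m)" by (simp add: power2_eq_square algebra_simps)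
  also have "\<dots> < R * R" using assms Q by (intro mult_strict_mono) auto
  finally have "2 * m * (Q * Q') < R"
    using assms by (metis power2_eq_square less_imp_le power_less_imp_less_base)
  then have "2 * m < R / (Q * Q')" using Q by (simp add: field_simps)
  also have "\<dots> = 1 * (R / (Q * Q'))" by simp
  also have "\<dots> \<le> \<bar>real_of_int (P * Q' - P' * Q)\<bar> * (R / (Q * Q'))"
    using one assms Q by (intro mult_right_mono) auto
  also have "\<dots> = \<bar>(b + P * R / Q) - (b + P' * R / Q')\<bar>"
    unfolding eq using assms Q by (simp add: abs_mult)
  finally show ?thesis .
qed

text \<open>A level shrinks the interval by 64 = 4 * 4 * 4, one quartering for each family i. At
  length m it treats all Q with 2 Q^2 m < R and stays m / 64 away from their fractions. A
  denominator not treated earlier has R \<le> 128 Q^2 m, which gives the constant 8192 = 128 * 64.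
  Level 0 is vacuous because R \<le> 128 l.\<close>

lemma badly_approximable_interval:
  fixes \<beta> R :: "nat \<Rightarrow> real"
  assumes l: "0 < l" and R: "\<And>i. i < 3 \<Longrightarrow> 0 < R i" "\<And>i. i < 3 \<Longrightarrow> R i \<le> 128 * l"
  shows "\<exists>a. a\<^sub>0 \<le> a \<and> a + l / 64 ^ k \<le> a\<^sub>0 + l \<and>
    (\<forall>i<3. \<forall>(Q :: int) (P :: int). 1 \<le> Q \<longrightarrow> 128 * (real_of_int Q)\<^sup>2 * l < R i * 64 ^ k \<longrightarrow>
      (\<forall>s\<in>{a..a + l / 64 ^ k}. R i / (8192 * (real_of_int Q)\<^sup>2) \<le> \<bar>s - (\<beta> i + P * R i / Q)\<bar>))"
proof (induction k)
  case 0
  have "\<not> 128 * (real_of_int Q)\<^sup>2 * l < R i" if "i < 3" "1 \<le> Q" for i and Q :: int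
  proof -
    have "1 \<le> (real_of_int Q)\<^sup>2" using that(2) by simp
    then have "128 * l * 1 \<le> 128 * l * (real_of_int Q)\<^sup>2" using l by (intro mult_left_mono) auto
    then show ?thesis using R(2)[OF that(1)] by (simp add: mult_ac)
  qed
  then show ?case by (intro exI[of _ a\<^sub>0]) auto
next
  case (Suc k)
  define m where "m = l / 64 ^ k"
  have m: "m > 0" using l by (simp add: m_def)
  obtain a where a: "a\<^sub>0 \<le> a" "a + m \<le> a\<^sub>0 + l"
    and old: "\<And>i (Q :: int) (P :: int) s. i < 3 \<Longrightarrow> 1 \<le> Q \<Longrightarrow> 128 * (real_of_int Q)\<^sup>2 * l < R i * 64 ^ k \<Longrightarrow> a \<le> s \<Longrightarrow> s \<le> a + m \<Longrightarrow>
      R i / (8192 * (real_of_int Q)\<^sup>2) \<le> \<bar>s - (\<beta> i + P * R i / Q)\<bar>"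
    using Suc unfolding m_def by auto
  define D where "D = (\<lambda>i. {\<beta> i + real_of_int P * R i / real_of_int Q | P Q. 1 \<le> Q \<and> 2 * (real_of_int Q)\<^sup>2 * m < R i})"
  have D: "2 * m' < \<bar>x - y\<bar>" if xy: "x \<in> D i" "y \<in> D i" "x \<noteq> y" "i < 3" "m' \<le> m" for x y i m'
  proof -
    obtain P Q P' Q' :: int where "x = \<beta> i + P * R i / Q" "y = \<beta> i + P' * R i / Q'"
      "1 \<le> Q" "1 \<le> Q'" "2 * (real_of_int Q)\<^sup>2 * m < R i" "2 * (real_of_int Q')\<^sup>2 * m < R i"
      using xy(1,2) unfolding D_def by blast
    then have "2 * m < \<bar>x - y\<bar>" using fractions_sparse[OF R(1)[OF xy(4)] m] xy(3) by simp
    then show ?thesis using xy(5) by simp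
  qed
  have step: "\<exists>a'\<ge>a. a' + m' / 4 \<le> a + m' \<and> (\<forall>x\<in>D i. \<forall>s\<in>{a'..a' + m' / 4}. m' / 4 \<le> \<bar>s - x\<bar>)"
    if "i < 3" "0 < m'" "m' \<le> m" for i m' a
    using avoid_sparse_points[of m' "D i" a] D[of _ i _ m'] that by blast
  obtain a\<^sub>1 where a\<^sub>1: "a \<le> a\<^sub>1" "a\<^sub>1 + m / 4 \<le> a + m"
    "\<forall>x\<in>D 0. \<forall>s\<in>{a\<^sub>1..a\<^sub>1 + m / 4}. m / 4 \<le> \<bar>s - x\<bar>"
    using step[of 0 m a] m by auto
  obtain a\<^sub>2 where a\<^sub>2: "a\<^sub>1 \<le> a\<^sub>2" "a\<^sub>2 + m / 4 / 4 \<le> a\<^sub>1 + m / 4"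
    "\<forall>x\<in>D 1. \<forall>s\<in>{a\<^sub>2..a\<^sub>2 + m / 4 / 4}. m / 4 / 4 \<le> \<bar>s - x\<bar>"
    using step[of 1 "m / 4" a\<^sub>1] m by auto
  obtain a\<^sub>3 where a\<^sub>3: "a\<^sub>2 \<le> a\<^sub>3" "a\<^sub>3 + m / 4 / 4 / 4 \<le> a\<^sub>2 + m / 4 / 4"
    "\<forall>x\<in>D 2. \<forall>s\<in>{a\<^sub>3..a\<^sub>3 + m / 4 / 4 / 4}. m / 4 / 4 / 4 \<le> \<bar>s - x\<bar>"
    using step[of 2 "m / 4 / 4" a\<^sub>2] m by auto
  have len: "l / 64 ^ Suc k = m / 4 / 4 / 4" by (simp add: m_def)
  have new: "m / 64 \<le> \<bar>s - x\<bar>" if i: "i < 3" and x: "x \<in> D i" and s: "s \<in> {a\<^sub>3..a\<^sub>3 + m / 4 / 4 / 4}" for i x s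
  proof -
    consider "i = 0" | "i = 1" | "i = 2" using i by linarith
    then show ?thesis
    proof cases
      case 1
      then have "m / 4 \<le> \<bar>s - x\<bar>" using a\<^sub>1(3) a\<^sub>2(1,2) a\<^sub>3(1,2) x s m by simp
      then show ?thesis using m by simp
    next
      case 2
      then have "m / 4 / 4 \<le> \<bar>s - x\<bar>" using a\<^sub>2(3) a\<^sub>3(1,2) x s m by simp
      then show ?thesis using m by simp
    next
      case 3
      then show ?thesis using a\<^sub>3(3) x s by simp
    qed
  qed
  have "R i / (8192 * (real_of_int Q)\<^sup>2) \<le> \<bar>s - (\<beta> i + P * R i / Q)\<bar>"
    if i: "i < 3" and Q: "1 \<le> Q" "128 * (real_of_int Q)\<^sup>2 * l < R i * 64 ^ Suc k" and s: "s \<in> {a\<^sub>3..a\<^sub>3 + m / 4 / 4 / 4}"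
    for i s and Q P :: int
  proof (cases "128 * (real_of_int Q)\<^sup>2 * l < R i * 64 ^ k")
    case True
    then show ?thesis using old[OF i Q(1) True, of s P] s a\<^sub>1(1,2) a\<^sub>2(1,2) a\<^sub>3(1,2) by simp
  next
    case False
    have Q0: "real_of_int Q > 0" using Q by simp
    have "2 * (real_of_int Q)\<^sup>2 * m < R i" using Q(2) by (simp add: m_def field_simps)
    then have "\<beta> i + P * R i / Q \<in> D i" using Q(1) unfolding D_def by blast
    then have "m / 64 \<le> \<bar>s - (\<beta> i + P * R i / Q)\<bar>" using new[OF i _ s] by blast
    moreover have "R i \<le> 128 * (real_of_int Q)\<^sup>2 * m" using False by (simp add: m_def field_simps)
    then have "R i / (8192 * (real_of_int Q)\<^sup>2) \<le> m / 64" using Q0 by (simp add: field_simps)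
    ultimately show ?thesis by linarith
  qed
  then show ?case
    unfolding len using a a\<^sub>1(1,2) a\<^sub>2(1,2) a\<^sub>3(1,2) by (intro exI[of _ a\<^sub>3]) auto
qed

theorem badly_approximable_integer:
  fixes \<beta> R :: "nat \<Rightarrow> real"
  assumes l: "1 \<le> l" and R: "\<And>i. i < 3 \<Longrightarrow> 0 < R i" "\<And>i. i < 3 \<Longrightarrow> R i \<le> 128 * l"
  shows "\<exists>s\<in>\<int>. a \<le> s \<and> s \<le> a + l \<and> (\<forall>i<3. \<forall>(Q :: int) (P :: int). 1 \<le> Q \<longrightarrow> 8192 * (real_of_int Q)\<^sup>2 \<le> R i \<longrightarrow>
    R i / (8192 * (real_of_int Q)\<^sup>2) \<le> \<bar>s - (\<beta> i + P * R i / Q)\<bar>)"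
proof -
  \<comment> \<open>The final length lies between 1 and 64: long enough to contain an integer, short
    enough that every Q with 8192 Q^2 \<le> R has been treated.\<close>
  define k where "k = nat \<lfloor>log 64 l\<rfloor>"
  have k: "64 ^ k \<le> l" "l < 64 * 64 ^ k"
  proof -
    have "real k \<le> log 64 l" "log 64 l < real (Suc k)"
      using l by (simp_all add: k_def le_log_iff) linarith+
    then have "64 powr real k \<le> l" "l < 64 powr real (Suc k)"
      using l by (simp_all add: le_log_iff log_less_iff)
    then show "64 ^ k \<le> l" "l < 64 * 64 ^ k"
      using powr_realpow[of 64 k] powr_realpow[of 64 "Suc k"] by simp_all
  qed
  obtain a' where a': "a \<le> a'" "a' + l / 64 ^ k \<le> a + l"
    and far: "\<And>i (Q :: int) (P :: int) s. i < 3 \<Longrightarrow> 1 \<le> Q \<Longrightarrow> 128 * (real_of_int Q)\<^sup>2 * l < R i * 64 ^ k \<Longrightarrow>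
      s \<in> {a'..a' + l / 64 ^ k} \<Longrightarrow> R i / (8192 * (real_of_int Q)\<^sup>2) \<le> \<bar>s - (\<beta> i + P * R i / Q)\<bar>"
    using badly_approximable_interval[of l R a k \<beta>] l R by (auto simp: Ball_def)
  define s where "s = real_of_int \<lceil>a'\<rceil>"
  have "1 \<le> l / 64 ^ k" using k(1) by simp
  then have s: "s \<in> {a'..a' + l / 64 ^ k}"
    unfolding s_def atLeastAtMost_iff using le_of_int_ceiling[of a'] ceiling_correct[of a'] by linarith
  have "128 * (real_of_int Q)\<^sup>2 * l < R i * 64 ^ k" if Q: "1 \<le> Q" "8192 * (real_of_int Q)\<^sup>2 \<le> R i" for i and Q :: int
  proof -
    have "128 * (real_of_int Q)\<^sup>2 * l < 128 * (real_of_int Q)\<^sup>2 * (64 * 64 ^ k)"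
      using k(2) Q(1) by (intro mult_strict_left_mono) auto
    also have "\<dots> = 8192 * (real_of_int Q)\<^sup>2 * 64 ^ k" by simp
    also have "\<dots> \<le> R i * 64 ^ k" using Q(2) by (intro mult_right_mono) auto
    finally show ?thesis .
  qed
  then have "R i / (8192 * (real_of_int Q)\<^sup>2) \<le> \<bar>s - (\<beta> i + P * R i / Q)\<bar>"
    if "i < 3" "1 \<le> Q" "8192 * (real_of_int Q)\<^sup>2 \<le> R i" for i and Q P :: int
    using far[OF that(1,2) _ s] that by simp
  moreover have "s \<in> \<int>" by (simp add: s_def)
  moreover have "a \<le> s" "s \<le> a + l" using s a' by simp_all
  ultimately show ?thesis by blast
qed

text \<open>Invariant: \<open>(h, r)\<close> is the image of \<open>(x, y)\<close> under a unimodular matrix with nonnegative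
  entries, so that \<open>x = D h - B r\<close> and \<open>y = A r - C h\<close>. As \<open>h / r\<close> is badly approximable, neither
  entry is ever much smaller than the other, and every subtraction shrinks the sum by a fixed factor.\<close>

lemma euclid_descent:
  fixes h r c c\<^sub>1 M T x y :: real and A B C D :: int
  assumes c: "0 < c\<^sub>1" "c\<^sub>1 \<le> c" "c \<le> 1" and M: "0 < M" "M < r" and T: "8 * r / (c\<^sub>1 * M) \<le> T"
    and BA: "\<And>(Q :: int) (P :: int). 1 \<le> Q \<Longrightarrow> Q \<le> T \<Longrightarrow> c * r / Q \<le> \<bar>Q * h - P * r\<bar>"
    and mat: "0 \<le> A" "0 \<le> B" "0 \<le> C" "1 \<le> D" "A * D - B * C = 1" "C \<le> T" "D \<le> T"
      "h = A * x + B * y" "r = C * x + D * y"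
    and xy: "x \<in> \<int>" "y \<in> \<int>" "0 < x" "0 < y" "C = 0 \<Longrightarrow> c\<^sub>1 * x \<le> y"
      "M < x + y \<or> c * M / 4 \<le> x"
  shows "\<exists>k x' y'. euclid x' y' k x y \<and> x' \<in> \<int> \<and> y' \<in> \<int> \<and> (1 + c\<^sub>1) ^ k * (x' + y') \<le> x + y \<and>
    c\<^sup>2 * M / 4 \<le> y' \<and> y' \<le> x' \<and> x' \<le> M"
proof -
  obtain n where "x + y \<le> real n" using real_arch_simple by blast
  then show ?thesis using mat xy
  proof (induction n arbitrary: A B C D x y)
    case 0
    then show ?case by simp
  next
    case (Suc n)
    note mat = Suc.prems(2-10) and xy = Suc.prems(11-16)
    have det: "real_of_int A * D - B * C = 1"
      using mat(5) by (metis of_int_1 of_int_diff of_int_mult)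
    have ge: "1 \<le> x" "1 \<le> y" using xy Ints_pos_ge_1 by auto
    have r0: "r > 0" using M by simp
    \<comment> \<open>By the determinant, x and y are up to sign the linear forms Q h - P r with Q =
      D and Q = C, so \<open>BA\<close> bounds them from below.\<close>
    have x_eq: "D * h - B * r = x"
    proof -
      have "D * h - B * r = (real_of_int A * D - B * C) * x" unfolding mat(8,9) by (simp add: algebra_simps)
      then show ?thesis using det by simp
    qed
    have y_eq: "C * h - A * r = - y"
    proof -
      have "C * h - A * r = - ((real_of_int A * D - B * C) * y)" unfolding mat(8,9) by (simp add: algebra_simps)
      then show ?thesis using det by simp
    qed
    have D0: "0 < real_of_int D" using mat(4) by simp
    have Cx: "C * x \<le> r" and Dy: "D * y \<le> r"
      using mat xy by (auto intro: mult_nonneg_nonneg simp: mat(9))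
    have rx: "c * y \<le> x"
    proof -
      have "c * y \<le> c * (r / D)" using Dy D0 c by (intro mult_left_mono) (auto simp: field_simps)
      also have "\<dots> \<le> x" using BA[OF mat(4,7), of B] x_eq xy(3) by simp
      finally show ?thesis .
    qed
    have ry: "c * x \<le> y" if "C \<noteq> 0"
    proof -
      have C: "1 \<le> C" "0 < real_of_int C" using that mat(3) by auto
      have "c * x \<le> c * (r / C)" using Cx C c by (intro mult_left_mono) (auto simp: field_simps)
      also have "\<dots> \<le> y" using BA[OF C(1) mat(6), of A] y_eq xy(4) by simp
      finally show ?thesis .
    qed
    have ry1: "c\<^sub>1 * x \<le> y"
    proof (cases "C = 0")
      case False
      have "c\<^sub>1 * x \<le> c * x" using c xy(3) by (intro mult_right_mono) auto
      then show ?thesis using ry[OF False] by simp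
    qed (use xy(5) in auto)
    \<comment> \<open>While C = 0 only the voltage has been reduced: y is still r, exceeds M, and
      the descent cannot stop. In this phase the ratio bound on x comes from the hypothesis with
      \<open>c\<^sub>1\<close>, since \<open>BA\<close> says nothing for Q = 0.\<close>
    have y_big: "y = r" if "C = 0"
    proof -
      have "A * D = 1" using mat(5) that by simp
      then have "D = 1" using mat(1,4) by (simp add: zmult_eq_1_iff)
      then show ?thesis using mat(9) that by simp
    qed
    \<comment> \<open>C \<le> r / x and D \<le> r / y are each at most T / 2, so the next
      denominator C + D is still covered by \<open>BA\<close>; hence the 8 in the hypothesis on
      T.\<close>
    have bound: "C + D \<le> T" if low: "c\<^sub>1 * M / 4 \<le> x" "c\<^sub>1 * M / 4 \<le> y"
    proof -
      have pos: "0 < c\<^sub>1 * M / 4" using c M by simp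
      define t where "t = r / (c\<^sub>1 * M / 4)"
      have "r / x \<le> t" "r / y \<le> t"
        unfolding t_def using r0 pos xy(3,4) mult_pos_pos low by (blast intro: less_imp_le divide_left_mono)+
      moreover have "C \<le> r / x" "D \<le> r / y" using Cx Dy xy by (auto simp: field_simps)
      moreover have "t + t \<le> T" using T by (simp add: t_def mult.commute)
      ultimately show ?thesis by simp
    qed
    have cM: "c\<^sub>1 * M / 4 \<le> c * M / 4" "c * M \<le> M" "0 < c * M" "0 < c"
      using c M by (auto intro: mult_right_mono mult_left_le_one_le)
    have big: "c * M / 2 \<le> x \<and> c\<^sub>1 * M / 2 \<le> y" if "M < x + y"
    proof (cases "x \<le> y")
      case True
      then have "c * (M / 2) \<le> c * y" "c\<^sub>1 * M \<le> M" using that c M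
        by (auto intro: mult_left_mono mult_left_le_one_le)
      then show ?thesis using rx True that by simp
    next
      case False
      then have "c\<^sub>1 * (M / 2) \<le> c\<^sub>1 * x" using that c by (intro mult_left_mono) auto
      then show ?thesis using ry1 cM False that by simp
    qed
    have pow: "(1 + c\<^sub>1) ^ Suc k * w \<le> z" if "(1 + c\<^sub>1) ^ k * w \<le> z'" "(1 + c\<^sub>1) * z' \<le> z" for k w z z'
    proof -
      have "(1 + c\<^sub>1) * ((1 + c\<^sub>1) ^ k * w) \<le> (1 + c\<^sub>1) * z'" using that(1) c by (intro mult_left_mono) auto
      then show ?thesis using that(2) by (simp add: mult.assoc)
    qed
    \<comment> \<open>A small sum alone does not end the descent: the next level needs current \<le>
      voltage, so parallel edges are removed as long as x < y. That x is then not tiny is what the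
      last hypothesis on x keeps track of.\<close>
    consider (stop) "x + y \<le> M" "y \<le> x" | (cur) "x < y" | (vol) "y \<le> x" "M < x + y" by linarith
    then show ?case
    proof cases
      case stop
      have "C \<noteq> 0" using y_big stop M xy by auto
      have "c * (c * M / 4) \<le> c * x" using xy(6) stop(1) cM by (intro mult_left_mono) auto
      then have "c\<^sup>2 * M / 4 \<le> y" using ry[OF \<open>C \<noteq> 0\<close>] by (simp add: power2_eq_square)
      then show ?thesis using stop xy by (intro exI[of _ 0] exI[of _ x] exI[of _ y]) (auto intro: euclid.refl)
    next
      case cur
      have low: "c * M / 4 \<le> x"
        using xy(6) big cM by auto
      then have CD: "C + D \<le> T" using cur cM by (intro bound) linarith+
      have "\<exists>k x' y'. euclid x' y' k x (y - x) \<and> x' \<in> \<int> \<and> y' \<in> \<int> \<and> (1 + c\<^sub>1) ^ k * (x' + y') \<le> x + (y - x) \<and>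
          c\<^sup>2 * M / 4 \<le> y' \<and> y' \<le> x' \<and> x' \<le> M"
      proof (rule Suc.IH[of x "y - x" "A + B" B "C + D" D])
        show "(A + B) * D - B * (C + D) = 1" using mat(5) by (simp add: algebra_simps)
        show "h = (A + B) * x + B * (y - x)" "r = (C + D) * x + D * (y - x)"
          by (simp_all add: mat(8,9) algebra_simps)
      qed (use Suc.prems(1) mat xy ge cur low CD in auto)
      then obtain k x' y' where k: "euclid x' y' k x (y - x)" "x' \<in> \<int>" "y' \<in> \<int>"
        "(1 + c\<^sub>1) ^ k * (x' + y') \<le> y" "c\<^sup>2 * M / 4 \<le> y'" "y' \<le> x'" "x' \<le> M" by auto
      have "c\<^sub>1 * y \<le> c * y" using c xy(4) by (intro mult_right_mono) auto
      then have "(1 + c\<^sub>1) ^ Suc k * (x' + y') \<le> x + y"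
        using rx by (intro pow[OF k(4)]) (simp add: algebra_simps)
      then show ?thesis using euclid.parallel[OF k(1)] k by (intro exI[of _ "Suc k"] exI[of _ x'] exI[of _ y']) auto
    next
      case vol
      have low: "c * M / 2 \<le> x" "c\<^sub>1 * M / 2 \<le> y" using big vol by auto
      have "0 < c\<^sub>1 * M" using c M by simp
      then have CD: "C + D \<le> T" using low cM by (intro bound) linarith+
      have CD1: "1 \<le> C + D" using mat by simp
      \<comment> \<open>The difference is the form with denominator C + D, so \<open>BA\<close>
        excludes x = y and keeps the new voltage from being tiny.\<close>
      have diff: "(C + D) * h - (A + B) * r = x - y"
        using x_eq y_eq by (simp add: algebra_simps)
      have "0 < c * r / (C + D)" using cM r0 CD1 by simp
      moreover have "c * r / (C + D) \<le> \<bar>x - y\<bar>" using BA[of "C + D" "A + B"] CD CD1 diff by simp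
      ultimately have gap: "c * r / (C + D) \<le> x - y" "0 < x - y" using vol by auto
      have "\<exists>k x' y'. euclid x' y' k (x - y) y \<and> x' \<in> \<int> \<and> y' \<in> \<int> \<and> (1 + c\<^sub>1) ^ k * (x' + y') \<le> (x - y) + y \<and>
          c\<^sup>2 * M / 4 \<le> y' \<and> y' \<le> x' \<and> x' \<le> M"
      proof (rule Suc.IH[of "x - y" y A "A + B" C "C + D"])
        show "A * (C + D) - (A + B) * C = 1" using mat(5) by (simp add: algebra_simps)
        show "h = A * (x - y) + (A + B) * y" "r = C * (x - y) + (C + D) * y"
          by (simp_all add: mat(8,9) algebra_simps)
        show "C = 0 \<Longrightarrow> c\<^sub>1 * (x - y) \<le> y" 
          using ry1 c xy(4) mult_left_mono[of "x - y" x c\<^sub>1] by linarith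
        show "M < x - y + y \<or> c * M / 4 \<le> x - y"
        proof (cases "M < x")
          case False
          have "c * y \<le> x - y"
          proof -
            have "(C + D) * y \<le> r"
            proof -
              have "0 \<le> C * (x - y)" using mat(3) gap(2) by simp
              then show ?thesis by (simp add: mat(9) algebra_simps)
            qed
            then have "c * y \<le> c * (r / (C + D))" using CD1 cM
              by (intro mult_left_mono) (auto simp: field_simps simp flip: of_int_add)
            then show ?thesis using gap(1) by simp
          qed
          moreover have "M / 4 \<le> x - y \<or> M / 4 \<le> y" using vol by linarith
          moreover have "c * M / 4 \<le> c * y" if "M / 4 \<le> y"
            using mult_left_mono[OF that, of c] cM(4) by simp
          ultimately have "c * M / 4 \<le> x - y" using cM(2) by linarith
          then show ?thesis ..
        qed simp
      qed (use Suc.prems(1) mat xy ge gap CD CD1 in auto)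
      then obtain k x' y' where k: "euclid x' y' k (x - y) y" "x' \<in> \<int>" "y' \<in> \<int>"
        "(1 + c\<^sub>1) ^ k * (x' + y') \<le> x" "c\<^sup>2 * M / 4 \<le> y'" "y' \<le> x'" "x' \<le> M" by auto
      have "(1 + c\<^sub>1) ^ Suc k * (x' + y') \<le> x + y"
        using ry1 by (intro pow[OF k(4)]) (simp add: algebra_simps)
      then show ?thesis using euclid.series[OF k(1)] k by (intro exI[of _ "Suc k"] exI[of _ x'] exI[of _ y']) auto
    qed
  qed
qed

section \<open>Passing to square roots\<close>

text \<open>The constants come from the approximation quality \<open>c = 1 / 8192 = 2\<^sup>-\<^sup>1\<^sup>3\<close>: the descent ends with
  entries at least \<open>c\<^sup>2 / 4 = 2\<^sup>-\<^sup>2\<^sup>8\<close> times the new size \<open>2\<^sup>3\<^sup>9 \<surd>L\<close>.\<close>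

definition balanced :: "real \<Rightarrow> real \<Rightarrow> real \<Rightarrow> bool" where
  "balanced L h r \<longleftrightarrow> h \<in> \<int> \<and> r \<in> \<int> \<and> L / 2 ^ 28 \<le> r \<and> r \<le> h \<and> h \<le> L"

text \<open>2^-29 is the guaranteed ratio of current to voltage before any subtraction: the current
  is at least \<open>L / 2 ^ 28\<close>, the voltage at most \<open>2 * L\<close>. The approximation
  quality 2^-13 is larger, so this ratio limits the rate.\<close>

abbreviation descent_rate :: real where
  "descent_rate \<equiv> ln (1 + 1 / 2 ^ 29)"

lemma euclid_to_balanced:
  fixes L h R x y :: real and A B C D :: int
  assumes L: "2 ^ 234 \<le> L"
    and mat: "0 \<le> A" "0 \<le> B" "0 \<le> C" "C \<le> 1" "1 \<le> D" "D \<le> 2" "A * D - B * C = 1"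
      "h = A * x + B * y" "R = C * x + D * y"
    and R: "L / 2 ^ 28 \<le> R" "R \<le> 2 * L"
    and xy: "x \<in> \<int>" "y \<in> \<int>" "0 < x" "0 < y" "C = 0 \<Longrightarrow> x / 2 ^ 29 \<le> y" "L / 2 ^ 30 \<le> x + y" "x + y \<le> 4 * L"
    and BA: "\<And>(Q :: int) (P :: int). 1 \<le> Q \<Longrightarrow> 8192 * (real_of_int Q)\<^sup>2 \<le> R \<Longrightarrow> R / (8192 * Q) \<le> \<bar>Q * h - P * R\<bar>"
  shows "\<exists>k x' y'. euclid x' y' k x y \<and> balanced (2 ^ 39 * sqrt L) x' y' \<and> real k * descent_rate \<le> ln (4 * L)"
proof -
  define q where "q = sqrt L"
  \<comment> \<open>The exponent 39 makes \<open>8 * R / (1 / 2 ^ 29 * M) \<le> T\<close> hold: the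
    left side is R / (2^7 sqrt L), whose square is at most R / 2^13 because R \<le> 2 L.
    \<open>T\<close> is the largest denominator for which approximability is given.\<close>
  define M where "M = 2 ^ 39 * q"
  define T where "T = sqrt (R / 8192)"
  have "sqrt ((2 ^ 117)\<^sup>2) \<le> q" unfolding q_def using L by (intro real_sqrt_le_mono) simp
  then have q: "2 ^ 117 \<le> q" by simp
  have L_eq: "L = q * q" using L by (simp add: q_def)
  have "2 ^ 117 * q \<le> L" unfolding L_eq using q by (intro mult_right_mono) auto
  then have M: "0 < M" "M < R" "M < x + y" using R(1) xy(6) q by (auto simp: M_def)
  have R0: "32768 \<le> R" using L R(1) by simp
  have "(8 * R / (1 / 2 ^ 29 * M))\<^sup>2 = R * (R / (2 ^ 14 * L))"
    using q unfolding M_def L_eq by (simp add: power2_eq_square field_simps)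
  also have "\<dots> \<le> R * (1 / 8192)"
    using R R0 L by (intro mult_left_mono) (auto simp: field_simps)
  finally have T8: "8 * R / (1 / 2 ^ 29 * M) \<le> T" unfolding T_def by (intro real_le_rsqrt) simp
  have T2: "2 \<le> T" unfolding T_def using R0 by (intro real_le_rsqrt) simp
  have "\<exists>k x' y'. euclid x' y' k x y \<and> x' \<in> \<int> \<and> y' \<in> \<int> \<and> (1 + 1 / 2 ^ 29) ^ k * (x' + y') \<le> x + y \<and>
    (1 / 8192)\<^sup>2 * M / 4 \<le> y' \<and> y' \<le> x' \<and> x' \<le> M"
  proof (rule euclid_descent[of "1 / 2 ^ 29" "1 / 8192" M R T h A B C D])
    fix Q P :: int assume Q: "1 \<le> Q" "Q \<le> T"
    have "(real_of_int Q)\<^sup>2 \<le> T\<^sup>2" using Q by (intro power_mono) auto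
    also have "T\<^sup>2 = R / 8192" using R0 by (simp add: T_def)
    finally show "1 / 8192 * R / Q \<le> \<bar>Q * h - P * R\<bar>" using BA[OF Q(1), of P] by simp
  next
    show "C \<le> T" "D \<le> T" using T2 mat(4,6) by linarith+
  qed (use mat M T8 xy in \<open>auto simp: field_simps\<close>)
  then obtain k x' y' where k: "euclid x' y' k x y" "x' \<in> \<int>" "y' \<in> \<int>" "(1 + 1 / 2 ^ 29) ^ k * (x' + y') \<le> x + y"
    "(1 / 8192)\<^sup>2 * M / 4 \<le> y'" "y' \<le> x'" "x' \<le> M" by blast
  have bal: "balanced M x' y'" using k by (simp add: balanced_def power2_eq_square)
  have "0 < y'" using k(5) M(1) by (simp add: power2_eq_square)
  then have "1 \<le> x' + y'" using Ints_pos_ge_1[OF k(3)] k(6) by simp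
  then have "(1 + 1 / 2 ^ 29) ^ k * 1 \<le> (1 + 1 / 2 ^ 29) ^ k * (x' + y')" by (intro mult_left_mono) auto
  then have "(1 + 1 / 2 ^ 29) ^ k \<le> 4 * L" using k(4) xy(7) by linarith
  then have "ln ((1 + 1 / 2 ^ 29) ^ k) \<le> ln (4 * L)" by (intro ln_mono) auto
  then have "real k * descent_rate \<le> ln (4 * L)" by (simp add: ln_realpow)
  then show ?thesis using k(1) bal unfolding M_def q_def by blast
qed

lemma row_far:
  fixes s b R h :: real and Q :: int
  assumes far: "\<And>P :: int. R / (8192 * (real_of_int Q)\<^sup>2) \<le> \<bar>s - (b + P * R / Q)\<bar>" and Q: "1 \<le> Q"
    and h: "h = s - b \<or> h = b - s"
  shows "R / (8192 * Q) \<le> \<bar>Q * h - (P :: int) * R\<bar>"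
proof -
  have Q0: "0 < real_of_int Q" using Q by simp
  have *: "R / (8192 * Q) \<le> \<bar>Q * (s - b) - P' * R\<bar>" for P' :: int
  proof -
    have "Q * (R / (8192 * (real_of_int Q)\<^sup>2)) \<le> Q * \<bar>s - (b + P' * R / Q)\<bar>"
      using far[of P'] Q0 by (intro mult_left_mono) auto
    also have "\<dots> = \<bar>Q * (s - (b + P' * R / Q))\<bar>" using Q0 by (simp add: abs_mult)
    also have "Q * (s - (b + P' * R / Q)) = Q * (s - b) - P' * R" using Q0 by (simp add: field_simps)
    finally show ?thesis using Q0 by (simp add: power2_eq_square)
  qed
  show ?thesis
    using h
  proof
    assume "h = b - s"
    then have "Q * h - P * R = - (Q * (s - b) - (- P) * R)" by (simp add: right_diff_distrib)
    then show ?thesis using *[of "- P"] by (simp only: abs_minus_cancel)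
  qed (use * in simp)
qed

lemma steps_bound:
  assumes "2 ^ 234 \<le> L" "real k * descent_rate \<le> ln (4 * L)"
  shows "real k \<le> 2 / descent_rate * ln L"
proof -
  have pos: "0 < descent_rate" by (rule ln_gt_zero) simp
  have "ln 4 \<le> ln L" using assms(1) by (intro ln_mono) auto
  moreover have "ln (4 * L) = ln 4 + ln L" using assms(1) by (intro ln_mult_pos) auto
  ultimately have "real k * descent_rate \<le> 2 * ln L" using assms(2) by linarith
  then show ?thesis using pos by (simp add: field_simps)
qed

lemma resistor_halve:
  assumes L: "2 ^ 234 \<le> L" and hr: "balanced L h r"
  shows "\<exists>x\<^sub>1 y\<^sub>1 x\<^sub>2 y\<^sub>2 k. balanced (2 ^ 39 * sqrt L) x\<^sub>1 y\<^sub>1 \<and> balanced (2 ^ 39 * sqrt L) x\<^sub>2 y\<^sub>2 \<and>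
    real k \<le> 4 / descent_rate * ln L \<and> (\<forall>n. resistor_pair n x\<^sub>1 y\<^sub>1 x\<^sub>2 y\<^sub>2 \<longrightarrow> resistor (n + k) h r)"
proof -
  have b: "h \<in> \<int>" "r \<in> \<int>" "L / 2 ^ 28 \<le> r" "r \<le> h" "h \<le> L" using hr by (auto simp: balanced_def)
  have r0: "2 \<le> r" using L b(3) by simp
  \<comment> \<open>Both voltages \<open>s\<close> and \<open>h - s\<close> are measured against the
    common current r, so the offsets are 0 and h; the third family repeats h. Choosing s between h /
    4 and 3 h / 4 keeps both voltages comparable to h.\<close>
  define \<beta> where "\<beta> = (\<lambda>i :: nat. if i = 0 then 0 else h)"
  have R: "1 \<le> h / 2" "0 < r" "r \<le> 128 * (h / 2)" using b(4) r0 by auto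
  obtain s where s: "s \<in> \<int>" "h / 4 \<le> s" "s \<le> h / 4 + h / 2"
    and far: "\<And>i (Q :: int) (P :: int). i < 3 \<Longrightarrow> 1 \<le> Q \<Longrightarrow> 8192 * (real_of_int Q)\<^sup>2 \<le> r \<Longrightarrow>
      r / (8192 * (real_of_int Q)\<^sup>2) \<le> \<bar>s - (\<beta> i + P * r / Q)\<bar>"
    using badly_approximable_integer[of "h / 2" "\<lambda>_. r" "h / 4" \<beta>] R by blast
  have row: "r / (8192 * Q) \<le> \<bar>Q * x - (P :: int) * r\<bar>"
    if "i < 3" "1 \<le> Q" "8192 * (real_of_int Q)\<^sup>2 \<le> r" "x = s - \<beta> i \<or> x = \<beta> i - s" for i and x :: real and Q P :: int
    using row_far[OF far[OF that(1-3)] that(2,4)] .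
  have "\<exists>k x' y'. euclid x' y' k s r \<and> balanced (2 ^ 39 * sqrt L) x' y' \<and> real k * descent_rate \<le> ln (4 * L)"
  proof (rule euclid_to_balanced[OF L, where A = 1 and B = 0 and C = 0 and D = 1 and h = s and R = r])
    fix Q P :: int assume "1 \<le> Q" "8192 * (real_of_int Q)\<^sup>2 \<le> r"
    then show "r / (8192 * Q) \<le> \<bar>Q * s - P * r\<bar>" using row[of 0 Q s P] by (simp add: \<beta>_def)
  qed (use b r0 s in auto)
  then obtain k\<^sub>1 x\<^sub>1 y\<^sub>1 where 1: "euclid x\<^sub>1 y\<^sub>1 k\<^sub>1 s r" "balanced (2 ^ 39 * sqrt L) x\<^sub>1 y\<^sub>1" "real k\<^sub>1 * descent_rate \<le> ln (4 * L)"
    by blast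
  have "\<exists>k x' y'. euclid x' y' k (h - s) r \<and> balanced (2 ^ 39 * sqrt L) x' y' \<and> real k * descent_rate \<le> ln (4 * L)"
  proof (rule euclid_to_balanced[OF L, where A = 1 and B = 0 and C = 0 and D = 1 and h = "h - s" and R = r])
    fix Q P :: int assume "1 \<le> Q" "8192 * (real_of_int Q)\<^sup>2 \<le> r"
    then show "r / (8192 * Q) \<le> \<bar>Q * (h - s) - P * r\<bar>" using row[of 1 Q "h - s" P] by (simp add: \<beta>_def)
  qed (use b r0 s in auto)
  then obtain k\<^sub>2 x\<^sub>2 y\<^sub>2 where 2: "euclid x\<^sub>2 y\<^sub>2 k\<^sub>2 (h - s) r" "balanced (2 ^ 39 * sqrt L) x\<^sub>2 y\<^sub>2" "real k\<^sub>2 * descent_rate \<le> ln (4 * L)"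
    by blast
  have "resistor (n + (k\<^sub>1 + k\<^sub>2)) h r" if "resistor_pair n x\<^sub>1 y\<^sub>1 x\<^sub>2 y\<^sub>2" for n
    using resistor_merge[OF resistor_pair_euclid_2[OF 2(1) resistor_pair_euclid_1[OF 1(1) that]]]
    by (simp add: add.assoc)
  moreover have "real (k\<^sub>1 + k\<^sub>2) \<le> 4 / descent_rate * ln L"
    using steps_bound[OF L 1(3)] steps_bound[OF L 2(3)] by simp
  ultimately show ?thesis using 1(2) 2(2) by blast
qed

lemma resistor_pair_halve:
  assumes L: "2 ^ 234 \<le> L" and hr: "balanced L h\<^sub>1 r\<^sub>1" "balanced L h\<^sub>2 r\<^sub>2"
  shows "\<exists>x\<^sub>1 y\<^sub>1 x\<^sub>2 y\<^sub>2 x\<^sub>3 y\<^sub>3 k. balanced (2 ^ 39 * sqrt L) x\<^sub>1 y\<^sub>1 \<and> balanced (2 ^ 39 * sqrt L) x\<^sub>2 y\<^sub>2 \<and>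
    balanced (2 ^ 39 * sqrt L) x\<^sub>3 y\<^sub>3 \<and> real k \<le> 6 / descent_rate * ln L + 2 \<and>
    (\<forall>m n. resistor_pair m x\<^sub>1 y\<^sub>1 x\<^sub>2 y\<^sub>2 \<longrightarrow> resistor n x\<^sub>3 y\<^sub>3 \<longrightarrow> resistor_pair (m + n + k) h\<^sub>1 r\<^sub>1 h\<^sub>2 r\<^sub>2)"
proof -
  have b: "h\<^sub>1 \<in> \<int>" "r\<^sub>1 \<in> \<int>" "L / 2 ^ 28 \<le> r\<^sub>1" "r\<^sub>1 \<le> h\<^sub>1" "h\<^sub>1 \<le> L"
    "h\<^sub>2 \<in> \<int>" "r\<^sub>2 \<in> \<int>" "L / 2 ^ 28 \<le> r\<^sub>2" "r\<^sub>2 \<le> h\<^sub>2" "h\<^sub>2 \<le> L" using hr by (auto simp: balanced_def)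
  have r0: "4 \<le> r\<^sub>1" "4 \<le> r\<^sub>2" "0 < L" using L b(3,8) by simp_all
  define \<beta> where "\<beta> = (\<lambda>i :: nat. if i = 0 then h\<^sub>1 else if i = 1 then - r\<^sub>2 else h\<^sub>2 + r\<^sub>1 - r\<^sub>2)"
  define R where "R = (\<lambda>i :: nat. if i = 0 then r\<^sub>1 else if i = 1 then r\<^sub>1 + r\<^sub>2 else r\<^sub>2)"
  have R: "1 \<le> (r\<^sub>1 + r\<^sub>2) / 4" "\<And>i. 0 < R i" "\<And>i. R i \<le> 128 * ((r\<^sub>1 + r\<^sub>2) / 4)"
    using r0 by (auto simp: R_def)
  \<comment> \<open>The interval puts \<open>r\<^sub>1 - s\<close> between 1/8 and 3/8 of
    \<open>r\<^sub>1 + r\<^sub>2\<close>, so both entries of the middle demand are comparable to the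
    currents. The outer voltages are at least \<open>r\<^sub>1 - s\<close>, because balanced demands
    have current \<le> voltage.\<close>
  obtain s where s: "s \<in> \<int>" "r\<^sub>1 - 3 * (r\<^sub>1 + r\<^sub>2) / 8 \<le> s" "s \<le> r\<^sub>1 - 3 * (r\<^sub>1 + r\<^sub>2) / 8 + (r\<^sub>1 + r\<^sub>2) / 4"
    and far: "\<And>i (Q :: int) (P :: int). i < 3 \<Longrightarrow> 1 \<le> Q \<Longrightarrow> 8192 * (real_of_int Q)\<^sup>2 \<le> R i \<Longrightarrow>
      R i / (8192 * (real_of_int Q)\<^sup>2) \<le> \<bar>s - (\<beta> i + P * R i / Q)\<bar>"
    using badly_approximable_integer[of "(r\<^sub>1 + r\<^sub>2) / 4" R "r\<^sub>1 - 3 * (r\<^sub>1 + r\<^sub>2) / 8" \<beta>] r0 R by blast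
  have row: "R i / (8192 * Q) \<le> \<bar>Q * h - (P :: int) * R i\<bar>"
    if "i < 3" "1 \<le> Q" "8192 * (real_of_int Q)\<^sup>2 \<le> R i" "h = s - \<beta> i \<or> h = \<beta> i - s" for i and h :: real and Q P :: int
    using row_far[OF far[OF that(1-3)] that(2,4)] .
  have "\<exists>k x' y'. euclid x' y' k (h\<^sub>1 - s) r\<^sub>1 \<and> balanced (2 ^ 39 * sqrt L) x' y' \<and> real k * descent_rate \<le> ln (4 * L)"
  proof (rule euclid_to_balanced[OF L, where A = 1 and B = 0 and C = 0 and D = 1 and h = "h\<^sub>1 - s" and R = r\<^sub>1])
    fix Q P :: int assume "1 \<le> Q" "8192 * (real_of_int Q)\<^sup>2 \<le> r\<^sub>1"
    then show "r\<^sub>1 / (8192 * Q) \<le> \<bar>Q * (h\<^sub>1 - s) - P * r\<^sub>1\<bar>"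
      using row[of 0 Q "h\<^sub>1 - s" P] by (simp add: R_def \<beta>_def)
  qed (use b r0 s in \<open>auto simp: field_simps\<close>)
  then obtain k\<^sub>1 x\<^sub>1 y\<^sub>1 where 1: "euclid x\<^sub>1 y\<^sub>1 k\<^sub>1 (h\<^sub>1 - s) r\<^sub>1" "balanced (2 ^ 39 * sqrt L) x\<^sub>1 y\<^sub>1"
    "real k\<^sub>1 * descent_rate \<le> ln (4 * L)" by blast
  \<comment> \<open>Here the current depends on s too. But the matrix with rows (1, 1) and (1, 2)
    maps this demand to \<open>(s + r\<^sub>2, r\<^sub>1 + r\<^sub>2)\<close>, whose second entry is
    free of s; the descent starts from that matrix.\<close>
  have "\<exists>k x' y'. euclid x' y' k (2 * s - r\<^sub>1 + r\<^sub>2) (r\<^sub>1 - s) \<and> balanced (2 ^ 39 * sqrt L) x' y' \<and>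
    real k * descent_rate \<le> ln (4 * L)"
  proof (rule euclid_to_balanced[OF L, where A = 1 and B = 1 and C = 1 and D = 2 and h = "s + r\<^sub>2" and R = "r\<^sub>1 + r\<^sub>2"])
    fix Q P :: int assume "1 \<le> Q" "8192 * (real_of_int Q)\<^sup>2 \<le> r\<^sub>1 + r\<^sub>2"
    then show "(r\<^sub>1 + r\<^sub>2) / (8192 * Q) \<le> \<bar>Q * (s + r\<^sub>2) - P * (r\<^sub>1 + r\<^sub>2)\<bar>"
      using row[of 1 Q "s + r\<^sub>2" P] by (simp add: R_def \<beta>_def)
  qed (use b r0 s in \<open>auto simp: field_simps\<close>)
  then obtain k\<^sub>2 x\<^sub>2 y\<^sub>2 where 2: "euclid x\<^sub>2 y\<^sub>2 k\<^sub>2 (2 * s - r\<^sub>1 + r\<^sub>2) (r\<^sub>1 - s)" "balanced (2 ^ 39 * sqrt L) x\<^sub>2 y\<^sub>2"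
    "real k\<^sub>2 * descent_rate \<le> ln (4 * L)" by blast
  have "\<exists>k x' y'. euclid x' y' k (h\<^sub>2 + r\<^sub>1 - r\<^sub>2 - s) r\<^sub>2 \<and> balanced (2 ^ 39 * sqrt L) x' y' \<and>
    real k * descent_rate \<le> ln (4 * L)"
  proof (rule euclid_to_balanced[OF L, where A = 1 and B = 0 and C = 0 and D = 1 and h = "h\<^sub>2 + r\<^sub>1 - r\<^sub>2 - s" and R = r\<^sub>2])
    fix Q P :: int assume "1 \<le> Q" "8192 * (real_of_int Q)\<^sup>2 \<le> r\<^sub>2"
    then show "r\<^sub>2 / (8192 * Q) \<le> \<bar>Q * (h\<^sub>2 + r\<^sub>1 - r\<^sub>2 - s) - P * r\<^sub>2\<bar>"
      using row[of 2 Q "h\<^sub>2 + r\<^sub>1 - r\<^sub>2 - s" P] by (simp add: R_def \<beta>_def)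
  qed (use b r0 s in \<open>auto simp: field_simps\<close>)
  then obtain k\<^sub>3 x\<^sub>3 y\<^sub>3 where 3: "euclid x\<^sub>3 y\<^sub>3 k\<^sub>3 (h\<^sub>2 + r\<^sub>1 - r\<^sub>2 - s) r\<^sub>2" "balanced (2 ^ 39 * sqrt L) x\<^sub>3 y\<^sub>3"
    "real k\<^sub>3 * descent_rate \<le> ln (4 * L)" by blast
  have "resistor_pair (m + n + (k\<^sub>1 + k\<^sub>2 + k\<^sub>3 + 2)) h\<^sub>1 r\<^sub>1 h\<^sub>2 r\<^sub>2"
    if "resistor_pair m x\<^sub>1 y\<^sub>1 x\<^sub>2 y\<^sub>2" "resistor n x\<^sub>3 y\<^sub>3" for m n
    using resistor_pair_bridge[OF resistor_pair_euclid_2[OF 2(1) resistor_pair_euclid_1[OF 1(1) that(1)]]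
      resistor_euclid[OF 3(1) that(2)]] by (simp add: add_ac)
  moreover have "real (k\<^sub>1 + k\<^sub>2 + k\<^sub>3 + 2) \<le> 6 / descent_rate * ln L + 2"
    using steps_bound[OF L 1(3)] steps_bound[OF L 2(3)] steps_bound[OF L 3(3)] by simp
  ultimately show ?thesis using 1(2) 2(2) 3(2) by blast
qed

text \<open>A pair of size \<open>L\<close> costs a pair and a resistor of size about \<open>\<surd>L\<close>, and a resistor costs a
  pair. Passing to square roots halves the logarithm while the number of parts grows only by
  the golden ratio per step, so the total cost stays logarithmic.\<close>

lemma balanced_cost:
  "\<exists>A>0. \<forall>L h r. 2 ^ 156 \<le> L \<longrightarrow> balanced L h r \<longrightarrow>
    (\<exists>n. real n \<le> A * (4 * ln L - 390 * ln 2) \<and> resistor n h r)"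
proof -
  define G where "G = 1 / descent_rate"
  \<comment> \<open>\<open>6 * G + 2\<close> pays for one level, \<open>2 ^ 235\<close> for demands
    of size up to \<open>2 ^ 234\<close>.\<close>
  define A where "A = 6 * G + 2 + 2 ^ 235"
  have "0 < descent_rate" by (rule ln_gt_zero) simp
  then have G: "0 < G" by (simp add: G_def)
  have A: "6 * G + 2 \<le> A" "2 ^ 235 \<le> A" "0 < A" using G by (auto simp: A_def)
  have ln2: "1 / 2 \<le> ln (2 :: real)" using ln2_ge_two_thirds by simp
  \<comment> \<open>One level replaces ln L by 39 ln 2 + ln L / 2 and costs at most A ln L. The
    coefficients solve the resulting recursion: 4 = 6/2 + 1 and 6 = (6 + 4)/2 + 1; for the offsets,
    390 = 624 - 6 * 39 and 624 = 624 + 390 - 10 * 39.\<close>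
  have main: "(\<forall>h r. balanced L h r \<longrightarrow> (\<exists>n. real n \<le> A * (4 * ln L - 390 * ln 2) \<and> resistor n h r)) \<and>
    (\<forall>h\<^sub>1 r\<^sub>1 h\<^sub>2 r\<^sub>2. balanced L h\<^sub>1 r\<^sub>1 \<longrightarrow> balanced L h\<^sub>2 r\<^sub>2 \<longrightarrow>
      (\<exists>n. real n \<le> A * (6 * ln L - 624 * ln 2) \<and> resistor_pair n h\<^sub>1 r\<^sub>1 h\<^sub>2 r\<^sub>2))"
    if "2 ^ 156 \<le> L" "L \<le> real N" for L N
    using that
  proof (induction N arbitrary: L)
    case 0
    then show ?case by simp
  next
    case (Suc N)
    have "ln (2 ^ 156) = real 156 * ln 2" by (rule ln_realpow)
    moreover have "ln (2 ^ 156) \<le> ln L" by (rule ln_mono[OF Suc.prems(1)]) simp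
    ultimately have lnL: "156 * ln 2 \<le> ln L" by linarith
    show ?case
    \<comment> \<open>Beyond \<open>2 ^ 234\<close> the next size \<open>2 ^ 39 * sqrt L\<close> is
      at least 2^(39 + 117) = 2^156, so the recursion stays within its domain.\<close>
    proof (cases "L \<le> 2 ^ 234")
      case True
      have single: "\<exists>n. real n \<le> 2 * L \<and> resistor n h r" if bal: "balanced L h r" for h r
      proof -
        have "0 < L / 2 ^ 28" using Suc.prems(1) by simp
        then have "h \<in> \<int>" "r \<in> \<int>" "0 < h" "0 < r" "h + r \<le> 2 * L" using bal by (auto simp: balanced_def)
        then show ?thesis using resistor_exists[of h r] by force
      qed
      have "A * 1 \<le> A * (4 * ln L - 390 * ln 2)" "A * 2 \<le> A * (6 * ln L - 624 * ln 2)"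
        by (intro mult_left_mono; use lnL ln2 A in linarith)+
      moreover have "2 * L \<le> A * 1" "4 * L \<le> A * 2" using True A(2) by simp_all
      ultimately have big: "2 * L \<le> A * (4 * ln L - 390 * ln 2)" "4 * L \<le> A * (6 * ln L - 624 * ln 2)"
        by (blast intro: order_trans)+
      have "\<exists>n. real n \<le> A * (6 * ln L - 624 * ln 2) \<and> resistor_pair n h\<^sub>1 r\<^sub>1 h\<^sub>2 r\<^sub>2"
        if hr: "balanced L h\<^sub>1 r\<^sub>1" "balanced L h\<^sub>2 r\<^sub>2" for h\<^sub>1 r\<^sub>1 h\<^sub>2 r\<^sub>2
      proof -
        obtain m n where "real m \<le> 2 * L" "resistor m h\<^sub>1 r\<^sub>1" "real n \<le> 2 * L" "resistor n h\<^sub>2 r\<^sub>2"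
          using single[OF hr(1)] single[OF hr(2)] by blast
        then show ?thesis using resistor_pairI big(2) by (intro exI[of _ "m + n"]) auto
      qed
      moreover have "\<exists>n. real n \<le> A * (4 * ln L - 390 * ln 2) \<and> resistor n h r" if "balanced L h r" for h r
        using single[OF that] big(1) by force
      ultimately show ?thesis by blast
    next
      case False
      then have L: "2 ^ 234 \<le> L" by simp
      define q where "q = sqrt L"
      have "sqrt ((2 ^ 117)\<^sup>2) \<le> q" unfolding q_def using L by (intro real_sqrt_le_mono) simp
      then have q: "2 ^ 117 \<le> q" by simp
      have L_eq: "L = q * q" using L by (simp add: q_def)
      have "2 ^ 117 * q \<le> L" unfolding L_eq using q by (intro mult_right_mono) auto
      then have M: "2 ^ 156 \<le> 2 ^ 39 * q" "2 ^ 39 * q \<le> real N" using q Suc.prems(2) by simp_all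
      have lnq: "ln L = 2 * ln q" using q by (simp add: L_eq ln_mult)
      have "ln (2 ^ 39 * q) = ln (2 ^ 39) + ln q" using q by (intro ln_mult_pos) auto
      moreover have "ln (2 ^ 39) = real 39 * ln 2" by (rule ln_realpow)
      ultimately have lnM: "ln (2 ^ 39 * q) = 39 * ln 2 + ln L / 2" using lnq by linarith
      note IH = Suc.IH[OF M, unfolded lnM]
      have AlnL: "6 * G * ln L + 2 \<le> A * ln L"
      proof -
        have "1 \<le> ln L" using lnL ln2 by linarith
        moreover have "(6 * G + 2) * ln L \<le> A * ln L"
          using A \<open>1 \<le> ln L\<close> by (intro mult_right_mono) auto
        ultimately show ?thesis by (simp add: algebra_simps)
      qed
      have "\<exists>n. real n \<le> A * (4 * ln L - 390 * ln 2) \<and> resistor n h r" if hr: "balanced L h r" for h r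
      proof -
        obtain x\<^sub>1 y\<^sub>1 x\<^sub>2 y\<^sub>2 k where k: "balanced (2 ^ 39 * q) x\<^sub>1 y\<^sub>1" "balanced (2 ^ 39 * q) x\<^sub>2 y\<^sub>2"
          "real k \<le> 4 * G * ln L" "\<forall>n. resistor_pair n x\<^sub>1 y\<^sub>1 x\<^sub>2 y\<^sub>2 \<longrightarrow> resistor (n + k) h r"
          using resistor_halve[OF L hr] unfolding q_def G_def by auto
        obtain n where n: "real n \<le> A * (6 * (39 * ln 2 + ln L / 2) - 624 * ln 2)" "resistor_pair n x\<^sub>1 y\<^sub>1 x\<^sub>2 y\<^sub>2"
          using IH k(1,2) by blast
        have "4 * G * ln L \<le> 6 * G * ln L" using G lnL ln2 by (intro mult_right_mono) auto
        then have "real (n + k) \<le> A * (4 * ln L - 390 * ln 2)"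
          using n(1) k(3) AlnL by (simp add: algebra_simps)
        then show ?thesis using k(4) n(2) by blast
      qed
      moreover have "\<exists>n. real n \<le> A * (6 * ln L - 624 * ln 2) \<and> resistor_pair n h\<^sub>1 r\<^sub>1 h\<^sub>2 r\<^sub>2"
        if hr: "balanced L h\<^sub>1 r\<^sub>1" "balanced L h\<^sub>2 r\<^sub>2" for h\<^sub>1 r\<^sub>1 h\<^sub>2 r\<^sub>2
      proof -
        obtain x\<^sub>1 y\<^sub>1 x\<^sub>2 y\<^sub>2 x\<^sub>3 y\<^sub>3 k where k: "balanced (2 ^ 39 * q) x\<^sub>1 y\<^sub>1" "balanced (2 ^ 39 * q) x\<^sub>2 y\<^sub>2"
          "balanced (2 ^ 39 * q) x\<^sub>3 y\<^sub>3" "real k \<le> 6 * G * ln L + 2"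
          "\<forall>m n. resistor_pair m x\<^sub>1 y\<^sub>1 x\<^sub>2 y\<^sub>2 \<longrightarrow> resistor n x\<^sub>3 y\<^sub>3 \<longrightarrow> resistor_pair (m + n + k) h\<^sub>1 r\<^sub>1 h\<^sub>2 r\<^sub>2"
          using resistor_pair_halve[OF L hr] unfolding q_def G_def by auto
        obtain m where m: "real m \<le> A * (6 * (39 * ln 2 + ln L / 2) - 624 * ln 2)" "resistor_pair m x\<^sub>1 y\<^sub>1 x\<^sub>2 y\<^sub>2"
          using IH k(1,2) by blast
        obtain n where n: "real n \<le> A * (4 * (39 * ln 2 + ln L / 2) - 390 * ln 2)" "resistor n x\<^sub>3 y\<^sub>3"
          using IH k(3) by blast
        have "real (m + n + k) \<le> A * (6 * ln L - 624 * ln 2)"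
          using m(1) n(1) k(4) AlnL by (simp add: algebra_simps)
        then show ?thesis using k(5) m(2) n(2) by blast
      qed
      ultimately show ?thesis by blast
    qed
  qed
  have "\<exists>n. real n \<le> A * (4 * ln L - 390 * ln 2) \<and> resistor n h r" if "2 ^ 156 \<le> L" "balanced L h r" for L h r
  proof -
    obtain N where "L \<le> real N" using real_arch_simple by blast
    then show ?thesis using main[OF that(1)] that(2) by blast
  qed
  then show ?thesis using A(3) by (intro exI[of _ A]) simp
qed

section \<open>Reduction of q / p to a balanced demand\<close>

lemma resistor_series_iterate: "resistor n h r \<Longrightarrow> resistor (n + k) (h + real k * r) r"
proof (induction k)
  case (Suc k)
  then show ?case using resistor_series[of "n + k" "h + real k * r" r] by (simp add: algebra_simps)
qed simp

theorem resistor_upper_bound: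
  "\<exists>C>0. \<forall>p q :: nat. 0 < p \<longrightarrow> p \<le> q \<longrightarrow>
    (\<exists>n. real n \<le> real q / real p + C * log 2 (real p) \<and> resistor n (real q) (real p))"
proof -
  obtain A where A: "A > 0" and cost: "\<forall>L h r. 2 ^ 156 \<le> L \<longrightarrow> balanced L h r \<longrightarrow>
      (\<exists>n. real n \<le> A * (4 * ln L - 390 * ln 2) \<and> resistor n h r)"
    using balanced_cost by (elim exE conjE) (rule that)
  \<comment> \<open>2^157 covers the plain algorithm for p < 2^155, where h + p \<le> 3 p;
    \<open>8 * A\<close> covers larger p.\<close>
  define C where "C = 2 ^ 157 + 8 * A"
  have "\<exists>n. real n \<le> real q / real p + C * log 2 (real p) \<and> resistor n (real q) (real p)"
    if p: "0 < p" "p \<le> q" for p q :: nat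
  proof -
    \<comment> \<open>One copy of p stays in h, so that p \<le> h \<le> 2 p and (h, p) is balanced
      at size 2 p. The other f copies become series edges; f + 1 \<le> q / p gives q / p the
      coefficient 1 and leaves one spare edge, which settles p = 1, where the logarithm
      vanishes.\<close>
    define h where "h = p + q mod p"
    define f where "f = q div p - 1"
    have "1 \<le> q div p" using p div_le_mono[of p q p] by simp
    then have f: "q div p = f + 1" by (simp add: f_def)
    have q: "real q = real h + real f * real p"
    proof -
      have "q = h + f * p" using div_mult_mod_eq[of q p] unfolding f h_def by (simp add: algebra_simps)
      then show ?thesis by (metis of_nat_add of_nat_mult)
    qed
    have h: "p \<le> h" "h \<le> 2 * p" using mod_less_divisor[OF p(1), of q] by (simp_all add: h_def)
    have le: "real f + 1 \<le> real q / real p"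
      using q h p by (simp add: field_simps)
    have "\<exists>n. real n \<le> 1 + C * log 2 (real p) \<and> resistor n (real h) (real p)"
    proof (cases "p = 1")
      case True
      then show ?thesis using resistor_unit[of 1] by (intro exI[of _ 1]) (simp add: h_def)
    next
      case False
      then have p2: "2 \<le> real p" using p by simp
      then have log1: "1 \<le> log 2 (real p)" by (simp add: le_log_iff)
      show ?thesis
      proof (cases "real p < 2 ^ 155")
        case True
        obtain n where n: "real n \<le> real h + real p" "resistor n (real h) (real p)"
          using resistor_exists[of "real h" "real p"] p h by auto
        have "real h \<le> 2 * real p" using h(2) by linarith
        then have "real n \<le> 2 ^ 157 * 1" using n(1) True by simp
        also have "\<dots> \<le> C * log 2 (real p)" using log1 A by (intro mult_mono) (auto simp: C_def)
        finally show ?thesis using n(2) by (intro exI[of _ n]) auto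
      next
        case False
        have "balanced (2 * real p) (real h) (real p)"
          using h by (auto simp: balanced_def)
        then obtain n where n: "real n \<le> A * (4 * ln (2 * real p) - 390 * ln 2)" "resistor n (real h) (real p)"
          using cost[rule_format, of "2 * real p"] False by auto
        have ln2: "0 < ln (2 :: real)" "ln (2 :: real) \<le> 1" using ln_2_less_1 by simp_all
        have lnp: "0 \<le> ln (real p)" "ln 2 \<le> ln (real p)" using p2 by (auto intro: ln_mono)
        have "ln (real p) \<le> log 2 (real p)"
          using mult_left_mono[OF ln2(2) lnp(1)] ln2(1) by (simp add: log_def field_simps)
        moreover have "ln (2 * real p) = ln 2 + ln (real p)" using p by (intro ln_mult_pos) auto
        ultimately have "4 * ln (2 * real p) - 390 * ln 2 \<le> 8 * log 2 (real p)"
          using lnp ln2 by linarith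
        then have "A * (4 * ln (2 * real p) - 390 * ln 2) \<le> A * (8 * log 2 (real p))"
          using A by (intro mult_left_mono) auto
        also have "\<dots> \<le> C * log 2 (real p)" using log1 by (simp add: C_def algebra_simps)
        finally show ?thesis using n by (intro exI[of _ n]) auto
      qed
    qed
    then obtain n where n: "real n \<le> 1 + C * log 2 (real p)" "resistor n (real h) (real p)" by blast
    have "resistor (n + f) (real q) (real p)" using resistor_series_iterate[OF n(2)] q by simp
    then show ?thesis using n(1) le by (intro exI[of _ "n + f"]) auto
  qed
  moreover have "C > 0" using A by (simp add: C_def)
  ultimately show ?thesis by blast
qed

theorem theorem3:
  shows "(\<forall>(G :: ('v, 'e) multigraph) a b (p :: nat) (q :: nat).
            finite_multigraph G \<and> connected_graph G \<and>
            a \<in> verts G \<and> b \<in> verts G \<and> a \<noteq> b \<and>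
            0 < p \<and> 0 < q \<and> coprime p q \<and> real q / real p > 1 \<and>
            effective_resistance G a b = real q / real p
            \<longrightarrow> real (card (edges G)) \<ge> max (real q / real p) (log 2 (real q)))
       \<and> (\<exists>C\<^sub>1 :: real. C\<^sub>1 > 0 \<and>
            (\<forall>(p :: nat) (q :: nat).
               0 < p \<and> 0 < q \<and> coprime p q \<and> real q / real p > 1
               \<longrightarrow> (\<exists>(G :: (nat, nat) multigraph) a b.
                     finite_multigraph G \<and> connected_graph G \<and> planar G \<and>
                     a \<in> verts G \<and> b \<in> verts G \<and> a \<noteq> b \<and>
                     effective_resistance G a b = real q / real p \<and>
                     real (card (edges G)) \<le> real q / real p + C\<^sub>1 * log 2 (real p))))"
proof (intro conjI allI impI)
  fix G :: "('v, 'e) multigraph" and a b p q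
  assume "finite_multigraph G \<and> connected_graph G \<and>
            a \<in> verts G \<and> b \<in> verts G \<and> a \<noteq> b \<and>
            0 < p \<and> 0 < q \<and> coprime p q \<and> real q / real p > 1 \<and>
            effective_resistance G a b = real q / real p"
  then show "real (card (edges G)) \<ge> max (real q / real p) (log 2 (real q))"
    using finite_multigraph.edges_lower_bound[of G a b p q] by simp
next
  obtain C where C: "C > 0" "\<forall>p q :: nat. 0 < p \<longrightarrow> p \<le> q \<longrightarrow>
      (\<exists>n. real n \<le> real q / real p + C * log 2 (real p) \<and> resistor n (real q) (real p))"
    using resistor_upper_bound by (elim exE conjE) (rule that)
  have "\<exists>(G :: (nat, nat) multigraph) a b. finite_multigraph G \<and> connected_graph G \<and> planar G \<and>
          a \<in> verts G \<and> b \<in> verts G \<and> a \<noteq> b \<and> effective_resistance G a b = real q / real p \<and>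
          real (card (edges G)) \<le> real q / real p + C * log 2 (real p)"
    if pq: "0 < p \<and> 0 < q \<and> coprime p q \<and> real q / real p > 1" for p q :: nat
  proof -
    have "p \<le> q" using pq by (auto simp: field_simps)
    then obtain n where n: "real n \<le> real q / real p + C * log 2 (real p)" "resistor n (real q) (real p)"
      using C(2) pq by blast
    have "frontier n [(real q, real p), (0, - real p)]"
      using resistorD[OF n(2), of 0 "[]" 0 0 "[]"] frontier_start by simp
    then show ?thesis using frontier_resistance[of n "real q" "real p"] pq n(1) by auto
  qed
  then show "\<exists>C\<^sub>1 :: real. C\<^sub>1 > 0 \<and>
            (\<forall>(p :: nat) (q :: nat).
               0 < p \<and> 0 < q \<and> coprime p q \<and> real q / real p > 1
               \<longrightarrow> (\<exists>(G :: (nat, nat) multigraph) a b.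
                     finite_multigraph G \<and> connected_graph G \<and> planar G \<and>
                     a \<in> verts G \<and> b \<in> verts G \<and> a \<noteq> b \<and>
                     effective_resistance G a b = real q / real p \<and>
                     real (card (edges G)) \<le> real q / real p + C\<^sub>1 * log 2 (real p)))"
    using C(1) by blast
qed

end
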